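(* Let $G$ be a connected graph for which there is an integer constant $k>2$ such that every vertex of $G$ has degree either $2$ or $k$. Suppose further that there is a finite constant $L>0$ such that every path in $G$ all of whose vertices have degree $2$ has length at most $L$. Then non-backtracking random walk is recurrent on $G$ if and only if simple random walk is recurrent on $G$.
   Context: Graphs are undirected and simple; $x\sim y$ means that $x$ and $y$ are adjacent, and $\deg(x)$ is the number of neighbours of $x$. Paths do not repeat vertices. Simple random walk on $G$ is the Markov chain on the vertices of $G$ which from a vertex $x$ moves to each neighbour of $x$ with probability $1/\deg(x)$. Non-backtracking random walk on $G$ is the random process $(X_n)_{n\ge 0}$ on the vertices of $G$ with transition probabilities $P(X_1=y\mid X_0=x)=\frac{1}{\deg(x)}$ if $y\sim x$ and $0$ otherwise, and, for $n\ge 1$, conditionally on the past up to time $n$ with $X_{n-1}=x_1$ and $X_n=x_2$, $P(X_{n+1}=y\mid X_n=x_2, X_{n-1}=x_1)=\frac{1}{\deg(x_2)-1}$ if $y\sim x_2$ and $y\ne x_1$, and $0$ if $y\not\sim x_2$ or $y=x_1$. A walk (simple or non-backtracking) is recurrent on $G$ if, for every starting vertex $v$, the walk started at $X_0=v$ almost surely visits $v$ infinitely often. *)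

theory Defs
  imports "HOL-Probability.Probability" "Graph_Theory.Graph_Theory"
begin

text \<open>
  A simple undirected graph, finite or infinite, is a pair digraph \<open>G\<close> whose arc relation is
  symmetric and irreflexive (\<^locale>\<open>pair_bidirected_digraph\<close>): each edge is represented by its
  two orientations. Connectedness and (vertex) paths are the library's notions for the digraph
  \<open>with_proj G\<close>.
\<close>

definition nbrs :: "'a pair_pre_digraph \<Rightarrow> 'a \<Rightarrow> 'a set" where
  "nbrs G x = {y. (x, y) \<in> parcs G}"

definition deg :: "'a pair_pre_digraph \<Rightarrow> 'a \<Rightarrow> nat" where
  "deg G x = card (nbrs G x)"

text \<open>
  \<open>X\<close> is a random process on \<open>V\<close>, defined on the probability space \<open>M\<close>, started at \<open>v\<close>, such that
  \<open>p n x y\<close> is the conditional probability of \<open>X (n + 1) = y\<close> given \<open>X 0 = x 0, ..., X n = x n\<close>,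
  for all histories of positive probability. In the instances below \<open>p n x y\<close> depends on \<open>x\<close> only
  through \<open>x 0, ..., x n\<close>.
\<close>

definition process_with_transitions ::
  "'a set \<Rightarrow> (nat \<Rightarrow> (nat \<Rightarrow> 'a) \<Rightarrow> 'a \<Rightarrow> real) \<Rightarrow> 'a \<Rightarrow> 'b measure \<Rightarrow> (nat \<Rightarrow> 'b \<Rightarrow> 'a) \<Rightarrow> bool"
where
  "process_with_transitions V p v M X \<longleftrightarrow>
     prob_space M \<and>
     (\<forall>n. X n \<in> measurable M (count_space V)) \<and>
     (AE \<omega> in M. X 0 \<omega> = v) \<and>
     (\<forall>n x y. \<P>(\<omega> in M. \<forall>i\<le>n. X i \<omega> = x i) > 0 \<longrightarrow>
        \<P>(\<omega> in M. X (Suc n) \<omega> = y \<bar> \<forall>i\<le>n. X i \<omega> = x i) = p n x y)"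

definition srw_transition :: "'a pair_pre_digraph \<Rightarrow> nat \<Rightarrow> (nat \<Rightarrow> 'a) \<Rightarrow> 'a \<Rightarrow> real" where
  "srw_transition G n x y = (if y \<in> nbrs G (x n) then 1 / real (deg G (x n)) else 0)"

definition nbrw_transition :: "'a pair_pre_digraph \<Rightarrow> nat \<Rightarrow> (nat \<Rightarrow> 'a) \<Rightarrow> 'a \<Rightarrow> real" where
  "nbrw_transition G n x y =
     (if n = 0 then (if y \<in> nbrs G (x 0) then 1 / real (deg G (x 0)) else 0)
      else if y \<in> nbrs G (x n) \<and> y \<noteq> x (n - 1) then 1 / (real (deg G (x n)) - 1) else 0)"

definition simple_random_walk ::
  "'a pair_pre_digraph \<Rightarrow> 'a \<Rightarrow> 'b measure \<Rightarrow> (nat \<Rightarrow> 'b \<Rightarrow> 'a) \<Rightarrow> bool"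
where
  "simple_random_walk G = process_with_transitions (pverts G) (srw_transition G)"

definition nonbacktracking_random_walk ::
  "'a pair_pre_digraph \<Rightarrow> 'a \<Rightarrow> 'b measure \<Rightarrow> (nat \<Rightarrow> 'b \<Rightarrow> 'a) \<Rightarrow> bool"
where
  "nonbacktracking_random_walk G = process_with_transitions (pverts G) (nbrw_transition G)"

text \<open>
  Recurrence is a property of the law of the walk. The quantifier over \<open>M\<close> and \<open>X\<close> ranges over
  processes whose sample points are trajectories, which loses no generality and is not vacuous for
  the graphs of interest: see the lemmas \<open>process_on_trajectories\<close>, \<open>ex_simple_random_walk\<close> and
  \<open>ex_nonbacktracking_random_walk\<close>.
\<close>

definition recurrent_on ::
  "'a pair_pre_digraph \<Rightarrow> ('a \<Rightarrow> (nat \<Rightarrow> 'a) measure \<Rightarrow> (nat \<Rightarrow> (nat \<Rightarrow> 'a) \<Rightarrow> 'a) \<Rightarrow> bool) \<Rightarrow> bool"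
where
  "recurrent_on G walk \<longleftrightarrow>
     (\<forall>v\<in>pverts G. \<forall>M X. walk v M X \<longrightarrow> (AE \<omega> in M. \<exists>\<^sub>\<infinity>n. X n \<omega> = v))"

definition srw_recurrent :: "'a pair_pre_digraph \<Rightarrow> bool" where
  "srw_recurrent G \<longleftrightarrow> recurrent_on G (simple_random_walk G)"

definition nbrw_recurrent :: "'a pair_pre_digraph \<Rightarrow> bool" where
  "nbrw_recurrent G \<longleftrightarrow> recurrent_on G (nonbacktracking_random_walk G)"

lemma process_on_trajectories:
  assumes "process_with_transitions V p v M X"
  defines "N \<equiv> distr M (\<Pi>\<^sub>M n\<in>UNIV. count_space V) (\<lambda>\<omega> n. X n \<omega>)"
  shows "process_with_transitions V p v N (\<lambda>n \<omega>. \<omega> n)"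
    and "(AE \<omega> in N. \<exists>\<^sub>\<infinity>n. \<omega> n = u) \<longleftrightarrow> (AE \<omega> in M. \<exists>\<^sub>\<infinity>n. X n \<omega> = u)"
proof -
  interpret prob_space M using assms(1) by (simp add: process_with_transitions_def)
  let ?P = "\<Pi>\<^sub>M n\<in>(UNIV::nat set). count_space V"
  have X [measurable]: "X n \<in> measurable M (count_space V)" for n
    using assms(1) by (simp add: process_with_transitions_def)
  have T [measurable]: "(\<lambda>\<omega> n. X n \<omega>) \<in> measurable M ?P"
    by (rule measurable_PiM_single') (use X in \<open>auto simp: measurable_def\<close>)
  have C [measurable]: "(\<lambda>\<omega>. \<omega> n) \<in> measurable ?P (count_space V)" for n
    by (rule measurable_component_singleton) simp
  have E [measurable]: "Measurable.pred ?P (\<lambda>\<omega>. \<omega> n = y)" for n y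
    by measurable
  have sN: "sets N = sets ?P" "space N = space ?P" by (simp_all add: N_def)
  have tr: "\<P>(\<omega> in N. Q \<omega>) = \<P>(\<omega> in M. Q (\<lambda>n. X n \<omega>))"
    if [measurable]: "Measurable.pred ?P Q" for Q
    unfolding N_def
    by (subst measure_distr) (auto simp: space_distr intro!: arg_cong[where f = "measure M"]
        dest: measurable_space[OF T])
  have ae: "(AE \<omega> in N. Q \<omega>) \<longleftrightarrow> (AE \<omega> in M. Q (\<lambda>n. X n \<omega>))"
    if [measurable]: "Measurable.pred ?P Q" for Q
    unfolding N_def by (rule AE_distr_iff[OF T]) simp
  have "prob_space N" unfolding N_def by (rule prob_space_distr[OF T])
  moreover have "(\<lambda>\<omega>. \<omega> n) \<in> measurable N (count_space V)" for n
    using C by (simp add: measurable_cong_sets[OF sN(1) refl])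
  moreover have "AE \<omega> in N. \<omega> 0 = v"
    using assms(1) by (subst ae) (auto simp: process_with_transitions_def)
  moreover have "\<P>(\<omega> in N. \<forall>i\<le>n. \<omega> i = x i) = \<P>(\<omega> in M. \<forall>i\<le>n. X i \<omega> = x i)" for n x
    by (rule tr) measurable
  moreover have "\<P>(\<omega> in N. \<omega> (Suc n) = y \<and> (\<forall>i\<le>n. \<omega> i = x i)) =
      \<P>(\<omega> in M. X (Suc n) \<omega> = y \<and> (\<forall>i\<le>n. X i \<omega> = x i))" for n x y
    by (rule tr) measurable
  ultimately show "process_with_transitions V p v N (\<lambda>n \<omega>. \<omega> n)"
    using assms(1) by (simp add: process_with_transitions_def cond_prob_def)
  show "(AE \<omega> in N. \<exists>\<^sub>\<infinity>n. \<omega> n = u) \<longleftrightarrow> (AE \<omega> in M. \<exists>\<^sub>\<infinity>n. X n \<omega> = u)"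
    by (rule ae) (unfold INFM_nat, measurable)
qed

text \<open>
  Histories are lists with the latest position first. For each history \<open>h\<close>, an independent uniform
  choice from \<open>S h\<close> decides the next position after \<open>h\<close>.
\<close>

primrec hist :: "'a \<Rightarrow> nat \<Rightarrow> ('a list \<Rightarrow> 'a) \<Rightarrow> 'a list" where
  "hist v 0 \<omega> = [v]"
| "hist v (Suc n) \<omega> = \<omega> (hist v n \<omega>) # hist v n \<omega>"

lemma ex_process_with_uniform_steps:
  fixes S :: "'a list \<Rightarrow> 'a set"
  assumes v: "v \<in> V"
    and S: "\<And>h. h \<noteq> [] \<Longrightarrow> set h \<subseteq> V \<Longrightarrow> finite (S h) \<and> S h \<noteq> {} \<and> S h \<subseteq> V"
    and p: "\<And>n x y. x 0 = v \<Longrightarrow> (\<And>i. i \<le> n \<Longrightarrow> x i \<in> V) \<Longrightarrow>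
              (\<And>i. i < n \<Longrightarrow> x (Suc i) \<in> S (rev (map x [0..<Suc i]))) \<Longrightarrow>
              p n x y = (if y \<in> S (rev (map x [0..<Suc n]))
                         then 1 / real (card (S (rev (map x [0..<Suc n])))) else 0)"
  shows "\<exists>(M :: (nat \<Rightarrow> 'a) measure) X. process_with_transitions V p v M X"
proof -
  define S' where "S' = (\<lambda>h. if h \<noteq> [] \<and> set h \<subseteq> V then S h else {v})"
  have S': "finite (S' h)" "S' h \<noteq> {}" "S' h \<subseteq> V" for h
    using S[of h] v by (auto simp: S'_def)
  let ?U = "\<lambda>h. uniform_count_measure (S' h)"
  define M where "M = Pi\<^sub>M UNIV ?U"
  interpret U: product_prob_space ?U UNIV
    using S' by (intro product_prob_spaceI prob_space_uniform_count_measure)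
  interpret prob_space M unfolding M_def by (intro prob_space_PiM prob_space_uniform_count_measure S')
  have spM: "space M = {\<omega>. \<forall>h. \<omega> h \<in> S' h}"
    by (auto simp: M_def space_PiM PiE_def Pi_def space_uniform_count_measure)
  define X where "X = (\<lambda>n \<omega>. hd (hist v n \<omega>))"
  define H where "H = (\<lambda>x n. rev (map x [0..<Suc n]) :: 'a list)"
  have H_Suc: "H x (Suc n) = x (Suc n) # H x n" for x n by (simp add: H_def)
  have lenH: "length (H x n) = Suc n" for x n by (simp add: H_def)
  have hist_H: "hist v n \<omega> = H (\<lambda>i. X i \<omega>) n" for n \<omega>
  proof (induction n)
    case (Suc n)
    have "hist v (Suc n) \<omega> = X (Suc n) \<omega> # hist v n \<omega>" by (simp add: X_def)
    then show ?case unfolding Suc.IH H_Suc .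
  qed (simp add: X_def H_def)
  have H_cong: "H x n = H x' n \<longleftrightarrow> (\<forall>i\<le>n. x i = x' i)" for x x' n
    by (auto simp: H_def)
  have X_Suc: "X (Suc n) \<omega> = \<omega> (H (\<lambda>i. X i \<omega>) n)" for n \<omega>
    unfolding hist_H[symmetric] by (simp add: X_def)
  have X0: "X 0 \<omega> = v" for \<omega> by (simp add: X_def)
  have path: "(\<forall>i\<le>n. X i \<omega> = x i) \<longleftrightarrow> (\<forall>i<n. \<omega> (H x i) = x (Suc i))" if "x 0 = v" for n x \<omega>
  proof (induction n)
    case (Suc n)
    have "(\<forall>i\<le>Suc n. X i \<omega> = x i) \<longleftrightarrow> (\<forall>i\<le>n. X i \<omega> = x i) \<and> X (Suc n) \<omega> = x (Suc n)"
      by (auto simp: le_Suc_eq)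
    also have "\<dots> \<longleftrightarrow> (\<forall>i\<le>n. X i \<omega> = x i) \<and> \<omega> (H x n) = x (Suc n)"
      using H_cong[of "\<lambda>i. X i \<omega>" n x] by (auto simp: X_Suc)
    finally show ?case using Suc.IH by (auto simp: less_Suc_eq)
  qed (simp add: X0 that)
  let ?A = "\<lambda>x h. {x (length h)} \<inter> S' h"
  let ?m = "\<lambda>x h. measure (?U h) (?A x h)"
  have emb: "{\<omega> \<in> space M. \<forall>i\<le>n. X i \<omega> = x i} =
      prod_emb UNIV ?U (H x ` {..<n}) (\<Pi>\<^sub>E h\<in>H x ` {..<n}. ?A x h)" if "x 0 = v" for n x
    using path[of x n, OF that]
    by (auto simp: prod_emb_def spM space_uniform_count_measure PiE_def Pi_def lenH space_PiM)
  have A_sets: "?A x h \<in> sets (?U h)" for x h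
    by (simp add: sets_uniform_count_measure)
  have ev_sets: "{\<omega> \<in> space M. \<forall>i\<le>n. X i \<omega> = x i} \<in> sets M" if "x 0 = v" for n x
    unfolding emb[of x n, OF that] unfolding M_def
    by (intro sets_PiM_I) (use A_sets in auto)
  have prob_path: "\<P>(\<omega> in M. \<forall>i\<le>n. X i \<omega> = x i) = (\<Prod>h\<in>H x ` {..<n}. ?m x h)"
    if "x 0 = v" for n x
    unfolding emb[of x n, OF that] unfolding M_def
    by (rule U.measure_PiM_emb) (use A_sets in auto)
  have X_V: "X n \<omega> \<in> V" if "\<omega> \<in> space M" for n \<omega>
    using that S'(3) v by (cases n) (auto simp: spM X0 X_Suc)
  have fin: "finite ((\<lambda>\<omega>. hist v n \<omega>) ` space M)" for n
  proof (induction n)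
    case (Suc n)
    have "(\<lambda>\<omega>. hist v (Suc n) \<omega>) ` space M \<subseteq>
        (\<Union>h\<in>(\<lambda>\<omega>. hist v n \<omega>) ` space M. (\<lambda>y. y # h) ` S' h)"
      by (auto simp: spM)
    then show ?case by (rule finite_subset) (intro finite_UN_I Suc.IH finite_imageI S'(1))
  qed (simp add: image_constant_conv)
  have X_meas: "X n \<in> measurable M (count_space V)" for n
  proof (rule measurableI)
    fix A
    let ?F = "{h \<in> (\<lambda>\<omega>. hist v n \<omega>) ` space M. hd h \<in> A}"
    have "X n -` A \<inter> space M = (\<Union>h\<in>?F. {\<omega> \<in> space M. hist v n \<omega> = h})"
      by (auto simp: X_def)
    also have "\<dots> \<in> sets M"
    proof (rule sets.finite_UN)
      fix h assume "h \<in> ?F"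
      then obtain \<omega>' where h: "h = hist v n \<omega>'" by blast
      show "{\<omega> \<in> space M. hist v n \<omega> = h} \<in> sets M"
        using ev_sets[of "\<lambda>i. X i \<omega>'" n, OF X0] unfolding h hist_H H_cong .
    qed (use fin[of n] in simp)
    finally show "X n -` A \<inter> space M \<in> sets M" .
  qed (use X_V in simp)
  have step: "\<P>(\<omega> in M. X (Suc n) \<omega> = y \<bar> \<forall>i\<le>n. X i \<omega> = x i) = p n x y"
    if pos: "\<P>(\<omega> in M. \<forall>i\<le>n. X i \<omega> = x i) > 0" for n x y
  proof -
    have "{\<omega> \<in> space M. \<forall>i\<le>n. X i \<omega> = x i} \<noteq> {}" using pos by force
    then obtain \<omega> where \<omega>: "\<omega> \<in> space M" "\<forall>i\<le>n. X i \<omega> = x i" by auto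
    have x0: "x 0 = v" using \<omega> X0 by (metis le0)
    have xV: "x i \<in> V" if "i \<le> n" for i using X_V[OF \<omega>(1), of i] \<omega>(2) that by simp
    have HV: "H x i \<noteq> [] \<and> set (H x i) \<subseteq> V" if "i \<le> n" for i
      using xV that by (auto simp: H_def)
    have SH: "S' (H x i) = S (H x i)" if "i \<le> n" for i using HV[OF that] by (simp add: S'_def)
    have "x (Suc i) \<in> S (H x i)" if "i < n" for i
      using \<omega> that SH[of i] path[of x n \<omega>, OF x0] unfolding spM by (metis (mono_tags) less_imp_le mem_Collect_eq)
    then have pn: "p n x y = (if y \<in> S (H x n) then 1 / real (card (S (H x n))) else 0)"
      using p[of x n y] x0 xV unfolding H_def by blast
    define x' where "x' = x(Suc n := y)"
    have x'0: "x' 0 = v" using x0 by (simp add: x'_def)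
    have H': "H x' i = H x i" if "i \<le> n" for i
      using that by (auto simp: x'_def H_cong)
    have eq: "(\<forall>i\<le>Suc n. X i \<omega> = x' i) \<longleftrightarrow> X (Suc n) \<omega> = y \<and> (\<forall>i\<le>n. X i \<omega> = x i)" for \<omega>
      by (auto simp: x'_def le_Suc_eq)
    have im: "H x' ` {..<n} = H x ` {..<n}" using H' by (intro image_cong) auto
    have notin: "H x n \<notin> H x ` {..<n}" using lenH by (metis imageE lessThan_iff less_irrefl nat.inject)
    have "\<P>(\<omega> in M. X (Suc n) \<omega> = y \<and> (\<forall>i\<le>n. X i \<omega> = x i)) = (\<Prod>h\<in>H x' ` {..<Suc n}. ?m x' h)"
      using prob_path[of x' "Suc n", OF x'0] unfolding eq .
    also have "\<dots> = ?m x' (H x n) * (\<Prod>h\<in>H x ` {..<n}. ?m x' h)"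
      using notin H' by (simp add: lessThan_Suc im)
    also have "(\<Prod>h\<in>H x ` {..<n}. ?m x' h) = (\<Prod>h\<in>H x ` {..<n}. ?m x h)"
      by (intro prod.cong refl) (auto simp: x'_def lenH)
    also have "\<dots> = \<P>(\<omega> in M. \<forall>i\<le>n. X i \<omega> = x i)" by (rule prob_path[of x n, OF x0, symmetric])
    also have "?m x' (H x n) = p n x y"
      using S'(1)[of "H x n"] SH[of n]
      by (simp add: pn lenH x'_def measure_uniform_count_measure)
    finally show ?thesis using pos by (simp add: cond_prob_def)
  qed
  have "process_with_transitions V p v M X"
    using X_meas step by (simp add: process_with_transitions_def prob_space_axioms X0)
  from process_on_trajectories(1)[OF this] show ?thesis by blast
qed

lemma ex_simple_random_walk:
  assumes "pair_bidirected_digraph G" "v \<in> pverts G"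
    and deg: "\<And>x. x \<in> pverts G \<Longrightarrow> deg G x \<ge> 1"
  shows "\<exists>(M :: (nat \<Rightarrow> 'a) measure) X. simple_random_walk G (v :: 'a) M X"
  unfolding simple_random_walk_def
proof (rule ex_process_with_uniform_steps[where S = "\<lambda>h. nbrs G (hd h)"])
  interpret pair_bidirected_digraph G by fact
  fix h :: "'a list" assume "h \<noteq> []" "set h \<subseteq> pverts G"
  then have "hd h \<in> pverts G" by (metis hd_in_set subsetD)
  from deg[OF this] have "card (nbrs G (hd h)) > 0" by (simp add: deg_def)
  then show "finite (nbrs G (hd h)) \<and> nbrs G (hd h) \<noteq> {} \<and> nbrs G (hd h) \<subseteq> pverts G"
    by (auto simp: card_gt_0_iff nbrs_def dest: in_arcsD2)
qed (use assms in \<open>simp_all add: srw_transition_def deg_def\<close>)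

lemma ex_nonbacktracking_random_walk:
  assumes "pair_bidirected_digraph G" "v \<in> pverts G"
    and deg: "\<And>x. x \<in> pverts G \<Longrightarrow> deg G x \<ge> 2"
  shows "\<exists>(M :: (nat \<Rightarrow> 'a) measure) X. nonbacktracking_random_walk G (v :: 'a) M X"
  unfolding nonbacktracking_random_walk_def
proof (rule ex_process_with_uniform_steps
    [where S = "\<lambda>h. nbrs G (hd h) - (if tl h = [] then {} else {hd (tl h)})"])
  interpret pair_bidirected_digraph G by fact
  fix h :: "'a list" assume "h \<noteq> []" "set h \<subseteq> pverts G"
  then have "hd h \<in> pverts G" by (metis hd_in_set subsetD)
  from deg[OF this] have c: "card (nbrs G (hd h)) \<ge> 2" by (simp add: deg_def)
  then have f: "finite (nbrs G (hd h))" by (metis card.infinite not_numeral_le_zero)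
  have "\<not> nbrs G (hd h) \<subseteq> {z}" for z
    using c card_mono[of "{z}" "nbrs G (hd h)"] by auto
  moreover have "nbrs G (hd h) \<noteq> {}" using c by auto
  ultimately show "finite (nbrs G (hd h) - (if tl h = [] then {} else {hd (tl h)})) \<and>
      nbrs G (hd h) - (if tl h = [] then {} else {hd (tl h)}) \<noteq> {} \<and>
      nbrs G (hd h) - (if tl h = [] then {} else {hd (tl h)}) \<subseteq> pverts G"
    using f by (auto simp: nbrs_def dest: in_arcsD2)
next
  interpret pair_bidirected_digraph G by fact
  fix n and x :: "nat \<Rightarrow> 'a" and y
  let ?S = "\<lambda>h. nbrs G (hd h) - (if tl h = [] then {} else {hd (tl h)})"
  assume V: "\<And>i. i \<le> n \<Longrightarrow> x i \<in> pverts G"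
    and st: "\<And>i. i < n \<Longrightarrow> x (Suc i) \<in> ?S (rev (map x [0..<Suc i]))"
  show "nbrw_transition G n x y = (if y \<in> ?S (rev (map x [0..<Suc n]))
          then 1 / real (card (?S (rev (map x [0..<Suc n])))) else 0)"
  proof (cases n)
    case 0
    then show ?thesis by (simp add: nbrw_transition_def deg_def)
  next
    case (Suc m)
    have "(x m, x n) \<in> parcs G" using st[of m] Suc by (simp add: nbrs_def)
    then have m: "x m \<in> nbrs G (x n)"
      using arcs_ends_symmetric[OF pair_sym_arcs] by (simp add: nbrs_def)
    have c: "card (nbrs G (x n)) \<ge> 2" using deg[OF V[of n]] by (simp add: deg_def)
    then have "finite (nbrs G (x n))" by (metis card.infinite not_numeral_le_zero)
    then have "real (card (nbrs G (x n) - {x m})) = real (card (nbrs G (x n))) - 1"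
      using m c by (simp add: card_Diff_singleton of_nat_diff)
    then show ?thesis using Suc by (simp add: nbrw_transition_def deg_def)
  qed
qed (use assms in simp_all)

end

theory Submission
  imports Defs
begin

text \<open>
  Both walks are chains on directed edges whose one-step operator is
  \<open>T f (x, y) = (1 + \<rho> y) * W y - \<rho> y * f (y, x)\<close>, where \<open>W y\<close> is the average of \<open>f\<close> over the edges
  leaving \<open>y\<close>; simple random walk has \<open>\<rho> = 0\<close>, the non-backtracking walk \<open>\<rho> y = 1 / (deg y - 1)\<close>.
  Up to reversal of edges, \<open>T\<close> fixes the functions that are constant on each star and contracts the
  mean-zero part by \<open>\<rho>\<close>. Hence, if \<open>f = t * T f + D\<close> with \<open>t < 1\<close>, the variance of \<open>f\<close> within the stars
  is controlled by the inner product of \<open>D\<close> and \<open>f\<close>. This has two consequences for either walk.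

  If the Green function diverges at \<open>v\<close>, then \<open>W\<close>, normalised at \<open>v\<close>, has arbitrarily small Dirichlet
  energy. Conversely, let \<open>f\<close> be the generating function of the hitting time of \<open>v\<close>. The flow
  \<open>f (x, y) - f (y, x)\<close> is almost divergence-free outside \<open>v\<close> and has bounded energy on the edges with
  an end where \<open>\<rho> < 1\<close>. Pairing it with functions \<open>\<phi>\<close> of small energy with \<open>\<phi> v = 1\<close> which are constant
  on the other edges shows that the walk returns to \<open>v\<close> almost surely.

  So each kind of recurrence produces functions of small energy, which in turn imply the other kind.
  Only the passage to the non-backtracking walk needs functions that are constant on the edges between
  vertices of degree 2; contracting the paths of such vertices, whose length is bounded,
  increases the energy by at most a constant factor.
\<close>

section \<open>Sums over directed edges\<close>

lemma summable_sq:
  fixes f :: "'b \<Rightarrow> real"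
  assumes f: "f summable_on A" "\<And>x. x \<in> A \<Longrightarrow> 0 \<le> f x"
  shows "(\<lambda>x. (f x)\<^sup>2) summable_on A"
proof (rule summable_on_comparison_test[OF summable_on_cmult_right[OF f(1), of "infsum f A"]])
  fix x assume x: "x \<in> A"
  have "f x \<le> infsum f A" using finite_sum_le_infsum[OF f(1), of "{x}"] x f(2) by auto
  then show "(f x)\<^sup>2 \<le> infsum f A * f x"
    using f(2)[OF x] by (simp add: power2_eq_square mult_right_mono)
qed simp

locale bounded_degree_graph =
  fixes V :: "'a set" and N :: "'a \<Rightarrow> 'a set" and K :: nat
  assumes N_subset: "x \<in> V \<Longrightarrow> N x \<subseteq> V"
    and finite_N: "x \<in> V \<Longrightarrow> finite (N x)"
    and N_nonempty: "x \<in> V \<Longrightarrow> N x \<noteq> {}"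
    and N_sym: "x \<in> V \<Longrightarrow> y \<in> N x \<Longrightarrow> x \<in> N y"
    and card_N_le: "x \<in> V \<Longrightarrow> card (N x) \<le> K"
begin

definition E :: "('a \<times> 'a) set" where "E = Sigma V N"

lemma E_iff: "(x, y) \<in> E \<longleftrightarrow> x \<in> V \<and> y \<in> N x"
  by (simp add: E_def)

lemma E_sym: "(x, y) \<in> E \<Longrightarrow> (y, x) \<in> E"
  using N_subset N_sym by (auto simp: E_iff)

lemma card_N_pos: "x \<in> V \<Longrightarrow> 0 < card (N x)"
  using finite_N N_nonempty by (simp add: card_gt_0_iff)

lemma bij_swap_E: "bij_betw prod.swap E E"
  by (rule bij_betw_byWitness[where f' = prod.swap]) (auto intro: E_sym)

lemma summable_swap: "(\<lambda>(x, y). f (y, x)) summable_on E \<longleftrightarrow> f summable_on E"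
  using summable_on_reindex_bij_betw[OF bij_swap_E, of f] by (simp add: case_prod_unfold prod.swap_def)

lemma infsum_swap: "infsum (\<lambda>(x, y). f (y, x)) E = infsum f E"
  using infsum_reindex_bij_betw[OF bij_swap_E, of f] by (simp add: case_prod_unfold prod.swap_def)

lemma infsum_stars:
  fixes f :: "'a \<times> 'a \<Rightarrow> real"
  assumes "f summable_on E"
  shows "infsum f E = (\<Sum>\<^sub>\<infinity>x\<in>V. \<Sum>y\<in>N x. f (x, y))"
  unfolding E_def infsum_Sigma_banach[OF assms[unfolded E_def], symmetric]
  by (intro infsum_cong) (simp add: finite_N)

lemma infsum_stars_eq:
  fixes f g :: "'a \<times> 'a \<Rightarrow> real"
  assumes "f summable_on E" "g summable_on E"
    and "\<And>x. x \<in> V \<Longrightarrow> (\<Sum>y\<in>N x. f (x, y)) = (\<Sum>y\<in>N x. g (x, y))"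
  shows "infsum f E = infsum g E"
  unfolding assms(1,2)[THEN infsum_stars] by (intro infsum_cong assms(3))

text \<open>The comparison is known only star by star, so a finite set of edges is first enlarged to
  the union of the full stars at its sources, which is still finite.\<close>

lemma
  fixes f g :: "'a \<times> 'a \<Rightarrow> real"
  assumes g: "g summable_on E" "\<And>e. e \<in> E \<Longrightarrow> 0 \<le> g e"
    and f: "\<And>e. e \<in> E \<Longrightarrow> 0 \<le> f e"
    and le: "\<And>x. x \<in> V \<Longrightarrow> (\<Sum>y\<in>N x. f (x, y)) \<le> (\<Sum>y\<in>N x. g (x, y))"
  shows summable_stars_le: "f summable_on E" and infsum_stars_le: "infsum f E \<le> infsum g E"
proof -
  have bd: "sum f A \<le> infsum g E" if A: "finite A" "A \<subseteq> E" for A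
  proof -
    have sub: "fst ` A \<subseteq> V" using A by (auto simp: E_iff)
    have fin: "finite (Sigma (fst ` A) N)" using A sub finite_N by (intro finite_SigmaI) auto
    have "sum f A \<le> sum f (Sigma (fst ` A) N)"
    proof (rule sum_mono2[OF fin])
      show "A \<subseteq> Sigma (fst ` A) N" using A by (force simp: E_iff)
      show "0 \<le> f e" if "e \<in> Sigma (fst ` A) N - A" for e
        by (rule f) (use that sub in \<open>auto simp: E_iff\<close>)
    qed
    also have "\<dots> = (\<Sum>x\<in>fst ` A. \<Sum>y\<in>N x. f (x, y))"
      using sub A finite_N by (subst sum.Sigma) auto
    also have "\<dots> \<le> (\<Sum>x\<in>fst ` A. \<Sum>y\<in>N x. g (x, y))"
      by (intro sum_mono le) (use sub in auto)
    also have "\<dots> = sum g (Sigma (fst ` A) N)"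
      using sub A finite_N by (subst sum.Sigma) auto
    also have "\<dots> \<le> infsum g E"
      by (rule finite_sum_le_infsum[OF g(1) fin]) (use sub g(2) in \<open>auto simp: E_iff\<close>)
    finally show ?thesis .
  qed
  show s: "f summable_on E"
    by (rule nonneg_bounded_partial_sums_imp_summable_on)
      (fact f, rule eventually_finite_subsets_at_top_weakI[OF bd])
  show "infsum f E \<le> infsum g E"
    by (rule infsum_le_finite_sums[OF s bd])
qed

lemma
  fixes f g :: "'a \<times> 'a \<Rightarrow> real"
  assumes g: "g summable_on E"
    and fg: "\<And>x y. (x, y) \<in> E \<Longrightarrow> 0 \<le> f (x, y)" "\<And>x y. (x, y) \<in> E \<Longrightarrow> f (x, y) \<le> g (x, y)"
  shows summable_le: "f summable_on E" and infsum_le: "infsum f E \<le> infsum g E"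
proof -
  show *: "f summable_on E"
    by (rule summable_on_comparison_test[OF g]) (use fg in auto)
  show "infsum f E \<le> infsum g E"
    by (rule infsum_mono[OF * g]) (use fg in auto)
qed

text \<open>Only the finitely many edges in \<open>N v \<times> {v}\<close> contribute. The source
  terms of both resolvent equations below have this form.\<close>

lemma
  fixes f :: "'a \<times> 'a \<Rightarrow> real"
  assumes v: "v \<in> V"
  shows summable_into: "(\<lambda>(x, y). of_bool (y = v) * f (x, y)) summable_on E"
    and infsum_into: "infsum (\<lambda>(x, y). of_bool (y = v) * f (x, y)) E = (\<Sum>x\<in>N v. f (x, v))"
proof -
  let ?g = "\<lambda>(x, y). of_bool (y = v) * f (x, y)"
  have sub: "N v \<times> {v} \<subseteq> E" and out: "\<And>e. e \<in> E - N v \<times> {v} \<Longrightarrow> ?g e = 0"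
    using N_subset[OF v] N_sym[OF v] E_sym[of _ v] by (auto simp: E_iff)
  have "?g summable_on E \<longleftrightarrow> ?g summable_on (N v \<times> {v})"
    by (rule summable_on_cong_neutral) (use sub out in auto)
  then show "?g summable_on E" using finite_N[OF v] by simp
  have "infsum ?g E = infsum ?g (N v \<times> {v})"
    by (rule infsum_cong_neutral) (use sub out in auto)
  also have "\<dots> = (\<Sum>x\<in>N v. f (x, v))"
    using finite_N[OF v] by (simp add: sum.cartesian_product[symmetric])
  finally show "infsum ?g E = (\<Sum>x\<in>N v. f (x, v))" .
qed

text \<open>Each vertex value is counted once per neighbour, hence at most \<open>K\<close>
  times.\<close>

lemma
  fixes f :: "'a \<Rightarrow> real"
  assumes f: "f summable_on V" "\<And>x. x \<in> V \<Longrightarrow> 0 \<le> f x"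
  shows summable_source: "(\<lambda>(x, y). f x) summable_on E"
    and infsum_source_le: "infsum (\<lambda>(x, y). f x) E \<le> K * infsum f V"
    and summable_nbr_sum: "(\<lambda>x. \<Sum>y\<in>N x. f y) summable_on V"
    and infsum_nbr_sum_le: "(\<Sum>\<^sub>\<infinity>x\<in>V. \<Sum>y\<in>N x. f y) \<le> K * infsum f V"
proof -
  have cs: "(\<lambda>x. card (N x) * f x) summable_on V"
    by (rule summable_on_comparison_test[OF summable_on_cmult_right[OF f(1), of K]])
      (use card_N_le f in \<open>auto intro!: mult_right_mono\<close>)
  show s: "(\<lambda>(x, y). f x) summable_on E"
    unfolding E_def
    by (rule summable_on_SigmaI[where g = "\<lambda>x. card (N x) * f x"])
      (use f cs in \<open>auto simp: finite_N intro: has_sum_finiteI\<close>)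
  have "infsum (\<lambda>(x, y). f x) E = (\<Sum>\<^sub>\<infinity>x\<in>V. card (N x) * f x)"
    by (subst infsum_stars[OF s]) simp
  also have "\<dots> \<le> (\<Sum>\<^sub>\<infinity>x\<in>V. K * f x)"
    by (rule infsum_mono[OF cs summable_on_cmult_right[OF f(1)]])
      (use card_N_le f in \<open>auto intro!: mult_right_mono\<close>)
  also have "\<dots> = K * infsum f V" by (rule infsum_cmult_right')
  finally show le: "infsum (\<lambda>(x, y). f x) E \<le> K * infsum f V" .
  have s': "(\<lambda>(x, y). f y) summable_on E"
    using s summable_swap[of "\<lambda>(x, y). f x"] by simp
  have eq: "(\<Sum>\<^sub>\<infinity>x\<in>V. \<Sum>y\<in>N x. f y) = infsum (\<lambda>(x, y). f y) E"
    by (subst infsum_stars[OF s']) simp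
  show "(\<Sum>\<^sub>\<infinity>x\<in>V. \<Sum>y\<in>N x. f y) \<le> K * infsum f V"
    using le infsum_swap[of "\<lambda>(x, y). f x"] by (simp add: eq)
  have "(\<lambda>x. infsum (\<lambda>y. (\<lambda>(x, y). f y) (x, y)) (N x)) summable_on V"
    using summable_on_Sigma_banach[OF s'[unfolded E_def]] by simp
  then show "(\<lambda>x. \<Sum>y\<in>N x. f y) summable_on V"
    by (rule summable_on_cong[THEN iffD1, rotated]) (simp add: finite_N)
qed

text \<open>The Dirichlet energy, with every undirected edge counted in both orientations.\<close>

definition energy :: "('a \<Rightarrow> real) \<Rightarrow> real" where
  "energy \<phi> = infsum (\<lambda>(x, y). (\<phi> x - \<phi> y)\<^sup>2) E"

lemma summable_energy:
  fixes \<phi> :: "'a \<Rightarrow> real"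
  assumes f: "\<phi> summable_on V" "\<And>x. x \<in> V \<Longrightarrow> 0 \<le> \<phi> x"
  shows "(\<lambda>(x, y). (\<phi> x - \<phi> y)\<^sup>2) summable_on E"
proof -
  let ?g = "\<lambda>(x, y). (\<phi> x)\<^sup>2"
  have s: "?g summable_on E"
    by (rule summable_source) (use summable_sq[OF f] in auto)
  have s': "(\<lambda>(x, y). (\<phi> y)\<^sup>2) summable_on E" using s summable_swap[of ?g] by simp
  show ?thesis
  proof (rule summable_le[OF summable_on_cmult_right[OF summable_on_add[OF s s'], of 2]])
    fix x y
    have "(\<phi> x - \<phi> y)\<^sup>2 \<le> 2 * ((\<phi> x)\<^sup>2 + (\<phi> y)\<^sup>2)"
      using zero_le_power2[of "\<phi> x + \<phi> y"] by (simp add: power2_eq_square algebra_simps)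
    then show "(\<lambda>(x, y). (\<phi> x - \<phi> y)\<^sup>2) (x, y) \<le> 2 * (?g (x, y) + (\<lambda>(x, y). (\<phi> y)\<^sup>2) (x, y))"
      by simp
  qed auto
qed

end

section \<open>Walks on directed edges\<close>

text \<open>\<open>\<rho>_card\<close> is the condition that \<open>ker y x y\<close> is
  nonnegative. \<open>\<rho>_gap\<close> makes the contraction of the mean-zero parts uniform over
  all vertices where \<open>\<rho>\<close> is not 1.\<close>

locale edge_walk = bounded_degree_graph V N K
  for V :: "'a set" and N :: "'a \<Rightarrow> 'a set" and K :: nat +
  fixes \<rho> :: "'a \<Rightarrow> real" and \<eta> :: real
  assumes \<rho>_nonneg: "x \<in> V \<Longrightarrow> 0 \<le> \<rho> x"
    and \<rho>_le_1: "x \<in> V \<Longrightarrow> \<rho> x \<le> 1"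
    and \<rho>_card: "x \<in> V \<Longrightarrow> \<rho> x * card (N x) \<le> 1 + \<rho> x"
    and \<eta>_pos: "0 < \<eta>"
    and \<rho>_gap: "x \<in> V \<Longrightarrow> \<rho> x \<noteq> 1 \<Longrightarrow> \<eta> \<le> 1 - (\<rho> x)\<^sup>2"
begin

text \<open>\<open>ker x y z\<close> is the probability of crossing \<open>(y, z)\<close> right after \<open>(x, y)\<close>. The choice \<open>\<rho> = 0\<close>
  gives simple random walk and \<open>\<rho> y = 1 / (card (N y) - 1)\<close> the non-backtracking walk, for which
  \<open>\<rho> y = 1\<close> exactly at the vertices of degree 2.\<close>

definition ker :: "'a \<Rightarrow> 'a \<Rightarrow> 'a \<Rightarrow> real" where
  "ker x y z = (1 + \<rho> y) / card (N y) - (if z = x then \<rho> y else 0)"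

definition avg :: "('a \<times> 'a \<Rightarrow> real) \<Rightarrow> 'a \<Rightarrow> real" where
  "avg f x = (\<Sum>y\<in>N x. f (x, y)) / card (N x)"

definition T :: "('a \<times> 'a \<Rightarrow> real) \<Rightarrow> 'a \<times> 'a \<Rightarrow> real" where
  "T f = (\<lambda>(x, y). \<Sum>z\<in>N y. ker x y z * f (y, z))"

section \<open>The transition operator on functions of directed edges\<close>

lemma sum_avg: "x \<in> V \<Longrightarrow> (\<Sum>y\<in>N x. f (x, y)) = card (N x) * avg f x"
  using card_N_pos[of x] by (simp add: avg_def)

lemma T_eq: "(x, y) \<in> E \<Longrightarrow> T f (x, y) = (1 + \<rho> y) * avg f y - \<rho> y * f (y, x)"
proof -
  assume e: "(x, y) \<in> E"
  then have y: "y \<in> V" "x \<in> N y" using E_sym[OF e] by (auto simp: E_iff)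
  have "T f (x, y) = (\<Sum>z\<in>N y. (1 + \<rho> y) / card (N y) * f (y, z) - (if z = x then \<rho> y * f (y, z) else 0))"
    by (auto simp: T_def ker_def left_diff_distrib intro!: sum.cong)
  also have "\<dots> = (1 + \<rho> y) * avg f y - \<rho> y * f (y, x)"
    using y finite_N[of y] by (simp add: sum_subtractf sum.delta avg_def sum_distrib_left sum_divide_distrib)
  finally show ?thesis .
qed

lemma ker_nonneg: "y \<in> V \<Longrightarrow> 0 \<le> ker x y z"
  using \<rho>_card[of y] \<rho>_nonneg[of y] card_N_pos[of y] by (auto simp: ker_def field_simps)

lemma sum_ker: "(x, y) \<in> E \<Longrightarrow> (\<Sum>z\<in>N y. ker x y z) = 1"
proof -
  assume e: "(x, y) \<in> E"
  then have y: "y \<in> V" using E_sym[OF e] by (auto simp: E_iff)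
  have "(\<Sum>z\<in>N y. ker x y z) = T (\<lambda>_. 1) (x, y)" by (simp add: T_def)
  also have "\<dots> = 1" using card_N_pos[OF y] by (simp add: T_eq[OF e] avg_def)
  finally show ?thesis .
qed

lemma T_mono:
  assumes "(x, y) \<in> E" "\<And>z. z \<in> N y \<Longrightarrow> f (y, z) \<le> g (y, z)"
  shows "T f (x, y) \<le> T g (x, y)"
  using assms E_sym[OF assms(1)] ker_nonneg[of y]
  by (auto simp: T_def E_iff intro!: sum_mono mult_left_mono)

lemma T_const: "(x, y) \<in> E \<Longrightarrow> T (\<lambda>_. c) (x, y) = c"
  using sum_ker[of x y] by (simp add: T_def sum_distrib_right[symmetric])

lemma T_add: "T (\<lambda>e. f e + g e) e = T f e + T g e"
  by (auto simp: T_def case_prod_unfold distrib_left sum.distrib)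

lemma T_nonneg: "(x, y) \<in> E \<Longrightarrow> (\<And>e. e \<in> E \<Longrightarrow> 0 \<le> f e) \<Longrightarrow> 0 \<le> T f (x, y)"
  using T_mono[of x y "\<lambda>_. 0" f] T_const[of x y 0] E_sym[of x y] by (auto simp: E_iff)

text \<open>The averaged part contributes \<open>1 + \<rho> y\<close> times the star sum and the
  reversal takes away \<open>\<rho> y\<close> times it. Thus counting measure on directed edges is
  invariant, which takes the place of reversibility.\<close>

lemma sum_T_into:
  assumes y: "y \<in> V"
  shows "(\<Sum>x\<in>N y. T f (x, y)) = (\<Sum>x\<in>N y. f (y, x))"
proof -
  have "(\<Sum>x\<in>N y. T f (x, y)) = (\<Sum>x\<in>N y. (1 + \<rho> y) * avg f y - \<rho> y * f (y, x))"
  proof (rule sum.cong[OF refl])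
    fix x assume "x \<in> N y"
    then have "(x, y) \<in> E" using E_sym[of y x] y by (simp add: E_iff)
    then show "T f (x, y) = (1 + \<rho> y) * avg f y - \<rho> y * f (y, x)" by (rule T_eq)
  qed
  also have "\<dots> = card (N y) * ((1 + \<rho> y) * avg f y) - \<rho> y * (card (N y) * avg f y)"
    by (simp add: sum_subtractf sum_distrib_left[symmetric] sum_avg[OF y])
  also have "\<dots> = (\<Sum>x\<in>N y. f (y, x))"
    by (simp add: sum_avg[OF y] algebra_simps)
  finally show ?thesis .
qed

text \<open>In each star \<open>T\<close> fixes the constants and multiplies the mean-zero part by \<open>- \<rho>\<close>.\<close>

lemma sum_T_sq_into:
  assumes y: "y \<in> V"
  shows "(\<Sum>x\<in>N y. (T f (x, y))\<^sup>2) =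
    (\<Sum>x\<in>N y. (f (y, x))\<^sup>2 - (1 - (\<rho> y)\<^sup>2) * (f (y, x) - avg f y)\<^sup>2)"
proof -
  let ?w = "avg f y"
  have "(\<Sum>x\<in>N y. (T f (x, y))\<^sup>2) = (\<Sum>x\<in>N y. (?w - \<rho> y * (f (y, x) - ?w))\<^sup>2)"
  proof (intro sum.cong refl)
    fix x assume "x \<in> N y"
    then have "(x, y) \<in> E" using E_sym[of y x] y by (simp add: E_iff)
    then show "(T f (x, y))\<^sup>2 = (?w - \<rho> y * (f (y, x) - ?w))\<^sup>2" by (simp add: T_eq algebra_simps)
  qed
  also have "\<dots> = (\<Sum>x\<in>N y. ((f (y, x))\<^sup>2 - (1 - (\<rho> y)\<^sup>2) * (f (y, x) - ?w)\<^sup>2)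
      - 2 * ?w * (1 + \<rho> y) * (f (y, x) - ?w))"
    by (intro sum.cong refl) (simp add: power2_eq_square algebra_simps)
  \<comment> \<open>The linear term disappears because the deviations from \<open>avg f y\<close>
    sum to 0 over the star.\<close>
  also have "\<dots> = (\<Sum>x\<in>N y. (f (y, x))\<^sup>2 - (1 - (\<rho> y)\<^sup>2) * (f (y, x) - ?w)\<^sup>2)"
    using sum_avg[OF y, of f] by (simp add: sum_subtractf sum_distrib_left[symmetric])
  finally show ?thesis .
qed

lemma sum_avg_sq_le: "x \<in> V \<Longrightarrow> (\<Sum>y\<in>N x. (avg f x)\<^sup>2) \<le> (\<Sum>y\<in>N x. (f (x, y))\<^sup>2)"
proof -
  assume x: "x \<in> V"
  have "(\<Sum>y\<in>N x. (f (x, y))\<^sup>2) - (\<Sum>y\<in>N x. (avg f x)\<^sup>2) = (\<Sum>y\<in>N x. (f (x, y) - avg f x)\<^sup>2 + 2 * avg f x * (f (x, y) - avg f x))"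
    unfolding sum_subtractf[symmetric] by (intro sum.cong refl) (simp add: power2_eq_square algebra_simps)
  also have "\<dots> = (\<Sum>y\<in>N x. (f (x, y) - avg f x)\<^sup>2)"
    using sum_avg[OF x, of f] by (simp add: sum.distrib sum_subtractf sum_distrib_left[symmetric])
  also have "\<dots> \<ge> 0" by (intro sum_nonneg) simp
  finally show ?thesis by simp
qed

lemma
  assumes f: "f summable_on E" "\<And>e. e \<in> E \<Longrightarrow> 0 \<le> f e"
  shows summable_T: "T f summable_on E" and infsum_T: "infsum (T f) E = infsum f E"
proof -
  have s: "(\<lambda>(x, y). T f (y, x)) summable_on E"
  proof (rule summable_stars_le[OF f])
    show "0 \<le> (\<lambda>(x, y). T f (y, x)) e" if "e \<in> E" for e
      using T_nonneg[OF E_sym f(2)] that by (cases e) simp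
  qed (simp_all add: sum_T_into f(2))
  then show "T f summable_on E" by (simp add: summable_swap)
  show "infsum (T f) E = infsum f E"
    unfolding infsum_swap[of "T f", symmetric]
    by (rule infsum_stars_eq[OF s f(1)]) (simp add: sum_T_into)
qed

text \<open>Weighted variance within stars; its total is the squared norm lost under
  \<open>T\<close>. The weight is 0 where \<open>\<rho> x = 1\<close>, so nothing is learnt about
  the deviations there.\<close>

definition spread :: "('a \<times> 'a \<Rightarrow> real) \<Rightarrow> 'a \<times> 'a \<Rightarrow> real" where
  "spread f = (\<lambda>(x, y). (1 - (\<rho> x)\<^sup>2) * (f (x, y) - avg f x)\<^sup>2)"

lemma spread_nonneg: "x \<in> V \<Longrightarrow> 0 \<le> spread f (x, y)"
  using \<rho>_nonneg[of x] \<rho>_le_1[of x] by (simp add: spread_def power_le_one)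

lemma
  assumes f: "f summable_on E" "\<And>e. e \<in> E \<Longrightarrow> 0 \<le> f e"
  shows summable_spread: "spread f summable_on E"
    and infsum_T_sq: "infsum (\<lambda>e. (T f e)\<^sup>2) E = infsum (\<lambda>e. (f e)\<^sup>2) E - infsum (spread f) E"
proof -
  note s = summable_sq[OF f]
  note sT = summable_sq[OF summable_T[OF f]]
  have sT: "(\<lambda>e. (T f e)\<^sup>2) summable_on E"
    by (rule sT) (use T_nonneg[OF _ f(2)] in auto)
  have sT': "(\<lambda>(x, y). (T f (y, x))\<^sup>2) summable_on E"
    using sT summable_swap[of "\<lambda>e. (T f e)\<^sup>2"] by simp
  have star: "(\<Sum>y\<in>N x. spread f (x, y)) = (\<Sum>y\<in>N x. (f (x, y))\<^sup>2) - (\<Sum>y\<in>N x. (T f (y, x))\<^sup>2)" if "x \<in> V" for x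
    unfolding sum_T_sq_into[OF that] by (simp add: spread_def sum_subtractf)
  show sp: "spread f summable_on E"
  proof (rule summable_stars_le[OF s])
    show "0 \<le> spread f e" if "e \<in> E" for e using that spread_nonneg by (cases e) (simp add: E_iff)
    show "(\<Sum>y\<in>N x. spread f (x, y)) \<le> (\<Sum>y\<in>N x. (f (x, y))\<^sup>2)" if "x \<in> V" for x
      unfolding star[OF that] by (simp add: sum_nonneg)
  qed simp_all
  have "infsum (\<lambda>e. (f e)\<^sup>2) E = infsum (\<lambda>e. spread f e + (\<lambda>(x, y). (T f (y, x))\<^sup>2) e) E"
    by (rule infsum_stars_eq[OF s summable_on_add[OF sp sT']]) (simp_all add: sum.distrib star)
  also have "\<dots> = infsum (spread f) E + infsum (\<lambda>(x, y). (T f (y, x))\<^sup>2) E"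
    by (rule infsum_add[OF sp sT'])
  also have "infsum (\<lambda>(x, y). (T f (y, x))\<^sup>2) E = infsum (\<lambda>e. (T f e)\<^sup>2) E"
    by (rule infsum_swap)
  finally show "infsum (\<lambda>e. (T f e)\<^sup>2) E = infsum (\<lambda>e. (f e)\<^sup>2) E - infsum (spread f) E" by simp
qed

text \<open>Squaring \<open>t * T f = f - D\<close> and dropping the square of \<open>D\<close>
  bounds the squared norm of \<open>f\<close> by that of \<open>t * T f\<close> plus twice the inner
  product with \<open>D\<close>. The loss under \<open>T\<close> given by \<open>infsum_T_sq\<close>
  then moves to the left.\<close>

lemma dissipation:
  assumes f: "f summable_on E" "\<And>e. e \<in> E \<Longrightarrow> 0 \<le> f e"
    and t: "0 \<le> t" "t \<le> 1"
    and D: "\<And>e. e \<in> E \<Longrightarrow> f e = t * T f e + D e" "\<And>e. e \<in> E \<Longrightarrow> 0 \<le> D e" "D summable_on E"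
    and Df: "(\<lambda>e. D e * f e) summable_on E"
  shows "(1 - t\<^sup>2) * infsum (\<lambda>e. (f e)\<^sup>2) E + t\<^sup>2 * infsum (spread f) E \<le> 2 * infsum (\<lambda>e. D e * f e) E"
proof -
  note s = summable_sq[OF f]
  have sT: "(\<lambda>e. (T f e)\<^sup>2) summable_on E"
    by (rule summable_sq[OF summable_T[OF f]]) (use T_nonneg[OF _ f(2)] in auto)
  have "infsum (\<lambda>e. (f e)\<^sup>2) E \<le> infsum (\<lambda>e. t\<^sup>2 * (T f e)\<^sup>2 + 2 * (D e * f e)) E"
  proof (rule infsum_mono[OF s])
    show "(\<lambda>e. t\<^sup>2 * (T f e)\<^sup>2 + 2 * (D e * f e)) summable_on E"
      by (intro summable_on_add summable_on_cmult_right sT Df)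
    fix e assume e: "e \<in> E"
    have "t\<^sup>2 * (T f e)\<^sup>2 = (f e - D e)\<^sup>2" using D(1)[OF e] by (simp add: power_mult_distrib)
    then show "(f e)\<^sup>2 \<le> t\<^sup>2 * (T f e)\<^sup>2 + 2 * (D e * f e)"
      by (simp add: power2_eq_square algebra_simps)
  qed
  also have "\<dots> = t\<^sup>2 * infsum (\<lambda>e. (T f e)\<^sup>2) E + 2 * infsum (\<lambda>e. D e * f e) E"
    by (subst infsum_add) (simp_all add: infsum_cmult_right' summable_on_cmult_right sT Df)
  finally show ?thesis by (simp add: infsum_T_sq[OF f] algebra_simps)
qed

text \<open>\<open>visit A B n (x, y)\<close>: the probability that the walk that has just crossed \<open>(x, y)\<close>
  is in \<open>A\<close> at times \<open>0, ..., n - 1\<close> and in \<open>B\<close> at time \<open>n\<close>, where \<open>y\<close> is its position at time \<open>0\<close>.\<close>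

primrec visit :: "'a set \<Rightarrow> 'a set \<Rightarrow> nat \<Rightarrow> 'a \<times> 'a \<Rightarrow> real" where
  "visit A B 0 = (\<lambda>(x, y). of_bool (y \<in> B))"
| "visit A B (Suc n) = (\<lambda>(x, y). of_bool (y \<in> A) * T (visit A B n) (x, y))"

section \<open>Visit probabilities and their generating functions\<close>

lemma visit_nonneg: "e \<in> E \<Longrightarrow> 0 \<le> visit A B n e"
proof (induction n arbitrary: e)
  case (Suc n)
  obtain x y where e: "e = (x, y)" by (cases e)
  have "0 \<le> T (visit A B n) (x, y)"
    using Suc.prems unfolding e by (rule T_nonneg) (rule Suc.IH)
  then show ?case by (simp add: e)
qed (simp add: case_prod_unfold)

lemma visit_le_1: "e \<in> E \<Longrightarrow> visit A B n e \<le> 1"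
proof (induction n arbitrary: e)
  case (Suc n)
  obtain x y where e: "e = (x, y)" by (cases e)
  have xy: "(x, y) \<in> E" using Suc.prems e by simp
  have "T (visit A B n) (x, y) \<le> T (\<lambda>_. 1) (x, y)"
  proof (rule T_mono[OF xy])
    fix z assume "z \<in> N y"
    then have "(y, z) \<in> E" using E_sym[OF xy] by (simp add: E_iff)
    then show "visit A B n (y, z) \<le> 1" by (rule Suc.IH)
  qed
  then show ?case unfolding T_const[OF xy] by (simp add: e of_bool_def)
qed (simp add: case_prod_unfold of_bool_def)

text \<open>At time 0 the sum counts the edges into \<open>v\<close>. Afterwards \<open>T\<close>
  preserves the total and the indicator of \<open>A\<close> can only remove mass.\<close>

lemma
  assumes v: "v \<in> V"
  shows summable_visit: "visit A {v} n summable_on E"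
    and infsum_visit_le: "infsum (visit A {v} n) E \<le> card (N v)"
proof (induction n)
  case 0
  case 1 show ?case using summable_into[OF v, of "\<lambda>_. 1"] by simp
  case 2 show ?case using infsum_into[OF v, of "\<lambda>_. 1"] by simp
next
  case (Suc n)
  let ?T = "T (visit A {v} n)"
  have *: "0 \<le> visit A {v} (Suc n) (x, y) \<and> visit A {v} (Suc n) (x, y) \<le> ?T (x, y)" if "(x, y) \<in> E" for x y
    using T_nonneg[OF that visit_nonneg] by (auto simp: of_bool_def)
  note s = summable_T[OF Suc(1) visit_nonneg]
  case 1 show ?case by (rule summable_le[OF s]) (use * in auto)
  case 2
  have "infsum (visit A {v} (Suc n)) E \<le> infsum ?T E"
    by (rule infsum_le[OF s]) (use * in auto)
  then show ?case using infsum_T[OF Suc(1) visit_nonneg] Suc(2) by simp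
qed

text \<open>For \<open>A = UNIV\<close> this is the Green function at \<open>v\<close> discounted by
  \<open>t\<close>, for \<open>A = -{v}\<close> the generating function of the hitting time of
  \<open>v\<close>.\<close>

definition resolvent :: "'a set \<Rightarrow> 'a \<Rightarrow> real \<Rightarrow> 'a \<times> 'a \<Rightarrow> real" where
  "resolvent A v t e = (\<Sum>n. t ^ n * visit A {v} n e)"

context
  fixes t :: real and v :: 'a and A :: "'a set"
  assumes t: "0 \<le> t" "t < 1" and v: "v \<in> V"
begin

lemma summable_resolvent_terms:
  assumes "e \<in> E" shows "summable (\<lambda>n. t ^ n * visit A {v} n e)"
proof (rule summable_comparison_test'[OF summable_geometric[of t]])
  show "norm (t ^ n * visit A {v} n e) \<le> t ^ n" if "n \<ge> 0" for n
    using visit_nonneg[OF assms, of A "{v}" n] visit_le_1[OF assms, of A "{v}" n] t(1)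
    by (simp add: mult_left_le)
qed (use t in simp)

lemma resolvent_nonneg: "e \<in> E \<Longrightarrow> 0 \<le> resolvent A v t e"
  unfolding resolvent_def
  by (intro suminf_nonneg summable_resolvent_terms mult_nonneg_nonneg visit_nonneg) (use t in auto)

text \<open>First-step analysis. For \<open>A = UNIV\<close> the source is the indicator of the
  edges into \<open>v\<close>; for \<open>A = -{v}\<close> the value on these edges is fixed at 1
  and the equation is homogeneous on all others.\<close>

lemma resolvent_eq:
  assumes e: "(x, y) \<in> E"
  shows "resolvent A v t (x, y) = of_bool (y = v) + of_bool (y \<in> A) * (t * T (resolvent A v t) (x, y))"
proof -
  have yz: "(y, z) \<in> E" if "z \<in> N y" for z using E_sym[OF e] that by (simp add: E_iff)
  have "T (resolvent A v t) (x, y) = (\<Sum>z\<in>N y. \<Sum>n. ker x y z * (t ^ n * visit A {v} n (y, z)))"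
    using summable_resolvent_terms[OF yz] by (simp add: T_def resolvent_def suminf_mult)
  also have "\<dots> = (\<Sum>n. \<Sum>z\<in>N y. ker x y z * (t ^ n * visit A {v} n (y, z)))"
    by (rule suminf_sum[symmetric]) (intro summable_mult summable_resolvent_terms yz)
  also have "\<dots> = (\<Sum>n. t ^ n * T (visit A {v} n) (x, y))"
    by (simp add: T_def sum_distrib_left mult_ac)
  finally have 1: "T (resolvent A v t) (x, y) = (\<Sum>n. t ^ n * T (visit A {v} n) (x, y))" .
  have sT: "summable (\<lambda>n. t ^ n * T (visit A {v} n) (x, y))"
  proof (rule summable_comparison_test'[OF summable_geometric[of t]])
    show "norm (t ^ n * T (visit A {v} n) (x, y)) \<le> t ^ n" if "n \<ge> 0" for n
      using T_nonneg[OF e, of "visit A {v} n", OF visit_nonneg] T_mono[OF e, of "visit A {v} n" "\<lambda>_. 1"]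
        T_const[OF e, of 1] visit_le_1[OF yz, of _ A "{v}" n] t(1)
      by (auto simp: mult_left_le)
  qed (use t in simp)
  have "resolvent A v t (x, y) =
      visit A {v} 0 (x, y) + (\<Sum>n. t ^ Suc n * visit A {v} (Suc n) (x, y))"
    unfolding resolvent_def using suminf_split_head[OF summable_resolvent_terms[OF e]] by simp
  also have "(\<Sum>n. t ^ Suc n * visit A {v} (Suc n) (x, y)) =
      (\<Sum>n. of_bool (y \<in> A) * t * (t ^ n * T (visit A {v} n) (x, y)))"
    by (intro suminf_cong) simp
  also have "\<dots> = of_bool (y \<in> A) * t * T (resolvent A v t) (x, y)"
    unfolding 1 by (rule suminf_mult[OF sT])
  finally show ?thesis by simp
qed

text \<open>The visit sums at each time are bounded by \<open>card (N v)\<close>, so the discount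
  makes the total a convergent geometric series.\<close>

lemma summable_resolvent: "resolvent A v t summable_on E"
proof (rule nonneg_bounded_partial_sums_imp_summable_on)
  show "\<forall>\<^sub>F X in finite_subsets_at_top E. sum (resolvent A v t) X \<le> (\<Sum>n. t ^ n * card (N v))"
  proof (rule eventually_finite_subsets_at_top_weakI)
    fix X assume X: "finite X" "X \<subseteq> E"
    have "sum (resolvent A v t) X = (\<Sum>n. \<Sum>e\<in>X. t ^ n * visit A {v} n e)"
      unfolding resolvent_def
      by (rule suminf_sum[symmetric], rule summable_resolvent_terms) (use X in auto)
    also have "\<dots> \<le> (\<Sum>n. t ^ n * card (N v))"
    proof (rule suminf_le)
      fix n
      have "sum (visit A {v} n) X \<le> infsum (visit A {v} n) E"
        by (rule finite_sum_le_infsum[OF summable_visit[OF v] X]) (simp add: visit_nonneg)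
      also have "\<dots> \<le> card (N v)" by (rule infsum_visit_le[OF v])
      finally show "(\<Sum>e\<in>X. t ^ n * visit A {v} n e) \<le> t ^ n * card (N v)"
        unfolding sum_distrib_left[symmetric] using t by (simp add: mult_left_mono)
      show "summable (\<lambda>n. \<Sum>e\<in>X. t ^ n * visit A {v} n e)"
        by (intro summable_sum summable_resolvent_terms) (use X in auto)
      show "summable (\<lambda>n. t ^ n * card (N v))"
        by (intro summable_mult2 summable_geometric) (use t in simp)
    qed
    finally show "sum (resolvent A v t) X \<le> (\<Sum>n. t ^ n * card (N v))" .
  qed
qed (rule resolvent_nonneg)

end
end

section \<open>Gradient and flow of resolvents\<close>

lemma sq_sum4_le: "(p + q + r + s)\<^sup>2 \<le> 4 * (p\<^sup>2 + q\<^sup>2 + r\<^sup>2 + s\<^sup>2)" for p q r s :: real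
  using sum_squares_bound[of p q] sum_squares_bound[of p r] sum_squares_bound[of p s]
    sum_squares_bound[of q r] sum_squares_bound[of q s] sum_squares_bound[of r s]
  by (simp add: power2_eq_square algebra_simps)

lemma sq_mult_le: "(c * p)\<^sup>2 \<le> p\<^sup>2" if "0 \<le> c" "c \<le> 1" for c p :: real
  using mult_right_mono[OF power_le_one[OF that, of 2], of "p\<^sup>2"] by (simp add: power_mult_distrib)

text \<open>Here \<open>a\<close>, \<open>b\<close> stand for \<open>f\<close> on the two
  orientations of an edge \<open>(x, y)\<close>, \<open>u\<close>, \<open>w\<close> for its averages
  at \<open>x\<close> and \<open>y\<close>, and \<open>c\<close>, \<open>d\<close> for the source
  terms. Eliminating \<open>b\<close> writes both differences through \<open>(1 - t) * u\<close>,
  \<open>a - u\<close>, \<open>c\<close> and \<open>d\<close> with bounded coefficients. Only the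
  deviation at one end enters, so control at that end is enough.\<close>

lemma edge_gradient:
  fixes t a b u w \<rho> \<sigma> c d :: real
  assumes t: "1/2 \<le> t" "t \<le> 1" and \<rho>: "0 \<le> \<rho>" "\<rho> \<le> 1" and \<sigma>: "0 \<le> \<sigma>" "\<sigma> \<le> 1"
    and a: "a = t * ((1 + \<sigma>) * w - \<sigma> * b) + c" and b: "b = t * ((1 + \<rho>) * u - \<rho> * a) + d"
  shows "(u - w)\<^sup>2 \<le> 16 * ((1 - t)\<^sup>2 * u\<^sup>2 + (a - u)\<^sup>2 + c\<^sup>2 + d\<^sup>2)"
    and "(a - b)\<^sup>2 \<le> 16 * ((1 - t)\<^sup>2 * u\<^sup>2 + (a - u)\<^sup>2 + c\<^sup>2 + d\<^sup>2)"
proof -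
  have p: "0 \<le> t * \<sigma>" "t * \<sigma> \<le> 1" "0 \<le> t * \<rho>" "t * \<rho> \<le> 1"
    using t \<rho> \<sigma> by (auto intro: mult_le_one)
  have q: "0 \<le> t * \<sigma> * (t * \<rho>)" "t * \<sigma> * (t * \<rho>) \<le> 1"
    using p by (auto intro: mult_le_one)
  let ?s = "t * (1 + \<sigma>)"
  have "?s * (w - u) = (1 - t * \<sigma>) * ((1 - t) * u) + (1 - t * \<sigma> * (t * \<rho>)) * (a - u) + t * \<sigma> * d + - c"
  proof -
    have "?s * (w - u) = (a - u) + (1 - t) * u + t * \<sigma> * (b - u) - c" by (simp add: a algebra_simps)
    also have "b - u = - (1 - t) * u - t * \<rho> * (a - u) + d" by (simp add: b algebra_simps)
    finally show ?thesis by (simp add: algebra_simps)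
  qed
  then have "(?s * (w - u))\<^sup>2 \<le> 4 * (((1 - t * \<sigma>) * ((1 - t) * u))\<^sup>2 +
      ((1 - t * \<sigma> * (t * \<rho>)) * (a - u))\<^sup>2 + (t * \<sigma> * d)\<^sup>2 + (- c)\<^sup>2)"
    by (simp only: sq_sum4_le)
  also have "\<dots> \<le> 4 * (((1 - t) * u)\<^sup>2 + (a - u)\<^sup>2 + d\<^sup>2 + c\<^sup>2)"
    using sq_mult_le[of "1 - t * \<sigma>" "(1 - t) * u"] sq_mult_le[of "1 - t * \<sigma> * (t * \<rho>)" "a - u"]
      sq_mult_le[of "t * \<sigma>" d] p q by simp
  finally have 1: "(?s * (w - u))\<^sup>2 \<le> 4 * (((1 - t) * u)\<^sup>2 + (a - u)\<^sup>2 + d\<^sup>2 + c\<^sup>2)" .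
  have "1/2 * 1 \<le> ?s" using t \<sigma> by (intro mult_mono) auto
  then have "(1/2)\<^sup>2 \<le> ?s\<^sup>2" by (intro power_mono) auto
  from mult_right_mono[OF this, of "(w - u)\<^sup>2"]
  have "1/4 * (w - u)\<^sup>2 \<le> (?s * (w - u))\<^sup>2"
    unfolding power_mult_distrib[of ?s] by (simp add: power_divide)
  with 1 have "1/4 * (w - u)\<^sup>2 \<le> 4 * ((1 - t)\<^sup>2 * u\<^sup>2 + (a - u)\<^sup>2 + c\<^sup>2 + d\<^sup>2)"
    by (simp add: power_mult_distrib)
  then show "(u - w)\<^sup>2 \<le> 16 * ((1 - t)\<^sup>2 * u\<^sup>2 + (a - u)\<^sup>2 + c\<^sup>2 + d\<^sup>2)"
    by (simp add: power2_commute[of w u])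
  have "a - b = (a - u) + t * \<rho> * (a - u) + (1 - t) * u + - d" by (simp add: b algebra_simps)
  then have "(a - b)\<^sup>2 \<le> 4 * ((a - u)\<^sup>2 + (t * \<rho> * (a - u))\<^sup>2 + ((1 - t) * u)\<^sup>2 + (- d)\<^sup>2)"
    by (simp only: sq_sum4_le)
  also have "\<dots> \<le> 16 * (((1 - t) * u)\<^sup>2 + (a - u)\<^sup>2 + c\<^sup>2 + d\<^sup>2)"
  proof -
    have "4 * (p + q + r + s) \<le> 16 * (r + p + l + s)"
      if "q \<le> p" "0 \<le> p" "0 \<le> r" "0 \<le> s" "0 \<le> l" for p q r s l :: real
      using that by simp
    from this[OF sq_mult_le[OF p(3,4)]] show ?thesis by simp
  qed
  finally show "(a - b)\<^sup>2 \<le> 16 * ((1 - t)\<^sup>2 * u\<^sup>2 + (a - u)\<^sup>2 + c\<^sup>2 + d\<^sup>2)"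
    by (simp add: power_mult_distrib)
qed

text \<open>When \<open>\<rho> = 1\<close> at both ends, the two equations place \<open>u\<close>
  and \<open>w\<close> near the mean of \<open>a\<close> and \<open>b\<close>, so they are close
  without any control of the deviations. The flow \<open>a - b\<close> is not bounded in this
  case.\<close>

lemma edge_gradient_degenerate:
  fixes t a b u w c d :: real
  assumes t: "1/2 \<le> t" and a: "a = t * (2 * w - b) + c" and b: "b = t * (2 * u - a) + d"
  shows "(u - w)\<^sup>2 \<le> 16 * ((1 - t)\<^sup>2 * (a\<^sup>2 + b\<^sup>2) + c\<^sup>2 + d\<^sup>2)"
proof -
  have "2 * t * (u - w) = (1 - t) * b + - ((1 - t) * a) + c + - d"
  proof -
    have "2 * t * w = a + t * b - c" using a by (simp add: algebra_simps)
    moreover have "2 * t * u = b + t * a - d" using b by (simp add: algebra_simps)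
    ultimately show ?thesis by (simp add: algebra_simps)
  qed
  then have "(2 * t * (u - w))\<^sup>2 \<le> 4 * (((1 - t) * b)\<^sup>2 + (- ((1 - t) * a))\<^sup>2 + c\<^sup>2 + (- d)\<^sup>2)"
    by (simp only: sq_sum4_le)
  moreover have "1 * (u - w)\<^sup>2 \<le> (2 * t)\<^sup>2 * (u - w)\<^sup>2"
    using one_le_power[of "2 * t" 2] t by (intro mult_right_mono) auto
  ultimately have "(u - w)\<^sup>2 \<le> 4 * ((1 - t)\<^sup>2 * (a\<^sup>2 + b\<^sup>2) + c\<^sup>2 + d\<^sup>2)"
    by (simp add: power_mult_distrib[of "2 * t"] power_mult_distrib[of "1 - t"] distrib_left)
  also have "\<dots> \<le> 16 * ((1 - t)\<^sup>2 * (a\<^sup>2 + b\<^sup>2) + c\<^sup>2 + d\<^sup>2)"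
    by (rule mult_right_mono) auto
  finally show ?thesis .
qed

context edge_walk
begin

text \<open>Collects the errors of both gradient estimates. Dividing by \<open>\<eta>\<close>
  recovers the plain squared deviation from \<open>spread\<close> where \<open>\<rho> x\<close> is
  not 1, and \<open>D\<close> majorises its own square because its values lie between 0 and
  1.\<close>

definition defect :: "real \<Rightarrow> ('a \<times> 'a \<Rightarrow> real) \<Rightarrow> ('a \<times> 'a \<Rightarrow> real) \<Rightarrow> 'a \<times> 'a \<Rightarrow> real" where
  "defect t f D = (\<lambda>(x, y). (1 - t)\<^sup>2 * ((f (x, y))\<^sup>2 + (avg f x)\<^sup>2) + spread f (x, y) / \<eta> + D (x, y))"

context
  fixes t :: real and f D :: "'a \<times> 'a \<Rightarrow> real"
  assumes t: "1/2 \<le> t" "t \<le> 1"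
    and f: "f summable_on E" "\<And>e. e \<in> E \<Longrightarrow> 0 \<le> f e"
    and D: "D summable_on E" "\<And>e. e \<in> E \<Longrightarrow> 0 \<le> D e" "\<And>e. e \<in> E \<Longrightarrow> D e \<le> 1"
    and fD: "\<And>e. e \<in> E \<Longrightarrow> f e = t * T f e + D e"
begin

lemma defect_ge:
  assumes e: "(x, y) \<in> E"
  shows "0 \<le> defect t f D (x, y)"
    and "(1 - t)\<^sup>2 * (f (x, y))\<^sup>2 + (D (x, y))\<^sup>2 \<le> defect t f D (x, y)"
    and "\<rho> x \<noteq> 1 \<Longrightarrow> (1 - t)\<^sup>2 * (avg f x)\<^sup>2 + (f (x, y) - avg f x)\<^sup>2 + (D (x, y))\<^sup>2 \<le> defect t f D (x, y)"
proof -
  have x: "x \<in> V" using e by (simp add: E_iff)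
  have DD: "(D (x, y))\<^sup>2 \<le> D (x, y)"
    using D(2,3)[OF e] mult_left_mono[of "D (x, y)" 1 "D (x, y)"] by (simp add: power2_eq_square)
  have s: "0 \<le> spread f (x, y) / \<eta>" using spread_nonneg[OF x] \<eta>_pos by simp
  have nn: "0 \<le> (1 - t)\<^sup>2 * (avg f x)\<^sup>2" "0 \<le> (1 - t)\<^sup>2 * (f (x, y))\<^sup>2" by simp_all
  have eq: "defect t f D (x, y) = (1 - t)\<^sup>2 * (f (x, y))\<^sup>2 + (1 - t)\<^sup>2 * (avg f x)\<^sup>2 +
      spread f (x, y) / \<eta> + D (x, y)"
    by (simp add: defect_def distrib_left)
  show "0 \<le> defect t f D (x, y)" using s nn D(2)[OF e] unfolding eq by linarith
  show "(1 - t)\<^sup>2 * (f (x, y))\<^sup>2 + (D (x, y))\<^sup>2 \<le> defect t f D (x, y)"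
    using s nn DD unfolding eq by linarith
  show "(1 - t)\<^sup>2 * (avg f x)\<^sup>2 + (f (x, y) - avg f x)\<^sup>2 + (D (x, y))\<^sup>2 \<le> defect t f D (x, y)" if "\<rho> x \<noteq> 1"
  proof -
    have "\<eta> * (f (x, y) - avg f x)\<^sup>2 \<le> spread f (x, y)"
      using \<rho>_gap[OF x that] by (simp add: spread_def mult_right_mono)
    then have "(f (x, y) - avg f x)\<^sup>2 \<le> spread f (x, y) / \<eta>"
      using \<eta>_pos by (simp add: field_simps)
    then show ?thesis using nn DD unfolding eq by linarith
  qed
qed

lemma f_eq: "(x, y) \<in> E \<Longrightarrow> f (x, y) = t * ((1 + \<rho> y) * avg f y - \<rho> y * f (y, x)) + D (x, y)"
  using fD T_eq by simp

text \<open>\<open>edge_gradient\<close> needs one end where \<open>\<rho>\<close> is not 1, and by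
  symmetry either end will do. If there is none, only the averages are controlled, by
  \<open>edge_gradient_degenerate\<close>.\<close>

lemma
  assumes e: "(x, y) \<in> E"
  shows avg_gradient_le: "(avg f x - avg f y)\<^sup>2 \<le> 16 * (defect t f D (x, y) + defect t f D (y, x))"
    and flow_sq_le: "\<rho> x \<noteq> 1 \<or> \<rho> y \<noteq> 1 \<Longrightarrow>
      (f (x, y) - f (y, x))\<^sup>2 \<le> 16 * (defect t f D (x, y) + defect t f D (y, x))"
proof -
  have *: "(avg f x - avg f y)\<^sup>2 \<le> 16 * (defect t f D (x, y) + defect t f D (y, x)) \<and>
      (f (x, y) - f (y, x))\<^sup>2 \<le> 16 * (defect t f D (x, y) + defect t f D (y, x))"
    if e: "(x, y) \<in> E" and "\<rho> x \<noteq> 1" for x y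
  proof -
    have V: "x \<in> V" "y \<in> V" using e E_sym[OF e] by (auto simp: E_iff)
    let ?R = "(1 - t)\<^sup>2 * (avg f x)\<^sup>2 + (f (x, y) - avg f x)\<^sup>2 + (D (x, y))\<^sup>2 + (D (y, x))\<^sup>2"
    have "0 \<le> (1 - t)\<^sup>2 * (f (y, x))\<^sup>2" by simp
    then have "?R \<le> defect t f D (x, y) + defect t f D (y, x)"
      using defect_ge(3)[OF e that(2)] defect_ge(2)[OF E_sym[OF e]] by linarith
    then have R: "16 * ?R \<le> 16 * (defect t f D (x, y) + defect t f D (y, x))" by simp
    note grad = edge_gradient[OF t \<rho>_nonneg[OF V(1)] \<rho>_le_1[OF V(1)] \<rho>_nonneg[OF V(2)] \<rho>_le_1[OF V(2)]
        f_eq[OF e] f_eq[OF E_sym[OF e]]]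
    from grad[THEN order_trans, OF R] show ?thesis by simp
  qed
  note e' = E_sym[OF e]
  show "(f (x, y) - f (y, x))\<^sup>2 \<le> 16 * (defect t f D (x, y) + defect t f D (y, x))" if "\<rho> x \<noteq> 1 \<or> \<rho> y \<noteq> 1"
    using that *[OF e] *[OF e'] by (auto simp: power2_commute[of "f (y, x)"] add.commute)
  show "(avg f x - avg f y)\<^sup>2 \<le> 16 * (defect t f D (x, y) + defect t f D (y, x))"
  proof (cases "\<rho> x = 1 \<and> \<rho> y = 1")
    case True
    have "(avg f x - avg f y)\<^sup>2 \<le> 16 * ((1 - t)\<^sup>2 * ((f (x, y))\<^sup>2 + (f (y, x))\<^sup>2) + (D (x, y))\<^sup>2 + (D (y, x))\<^sup>2)"
      by (rule edge_gradient_degenerate[OF t(1)]) (use f_eq[OF e] f_eq[OF e'] True in simp_all)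
    also have "\<dots> \<le> 16 * (defect t f D (x, y) + defect t f D (y, x))"
      using defect_ge(2)[OF e] defect_ge(2)[OF e'] by (simp add: distrib_left)
    finally show ?thesis .
  next
    case False
    then show ?thesis
      using *[OF e] *[OF e'] by (auto simp: power2_commute[of "avg f y"] add.commute)
  qed
qed

text \<open>Both quadratic parts come from \<open>dissipation\<close>:
  \<open>1/4 \<le> t\<^sup>2\<close> bounds the spread by 8 times the inner product of
  \<open>D\<close> and \<open>f\<close>, and \<open>(1 - t)\<^sup>2 \<le> 1 - t\<^sup>2\<close>
  bounds the norm term by 2 times it. The latter enters twice, since averaging over stars does not
  increase the norm.\<close>

lemma
  assumes Df: "(\<lambda>e. D e * f e) summable_on E"
  shows summable_defect: "defect t f D summable_on E"
    and infsum_defect_le: "infsum (defect t f D) E \<le> (4 + 8 / \<eta>) * infsum (\<lambda>e. D e * f e) E + infsum D E"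
proof -
  note s = summable_sq[OF f]
  note sp = summable_spread[OF f]
  have avs: "(\<lambda>(x, y). (avg f x)\<^sup>2) summable_on E" and av: "infsum (\<lambda>(x, y). (avg f x)\<^sup>2) E \<le> infsum (\<lambda>e. (f e)\<^sup>2) E"
    by (rule summable_stars_le[OF s] infsum_stars_le[OF s]; use sum_avg_sq_le[of _ f] in force)+
  have s1: "(\<lambda>e. (1 - t)\<^sup>2 * ((f e)\<^sup>2 + (\<lambda>(x, y). (avg f x)\<^sup>2) e)) summable_on E"
    by (intro summable_on_cmult_right summable_on_add s avs)
  have s2: "(\<lambda>e. 1 / \<eta> * spread f e) summable_on E" by (intro summable_on_cmult_right sp)
  have eq: "defect t f D = (\<lambda>e. (1 - t)\<^sup>2 * ((f e)\<^sup>2 + (\<lambda>(x, y). (avg f x)\<^sup>2) e) + 1 / \<eta> * spread f e + D e)"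
    by (auto simp: defect_def fun_eq_iff)
  show "defect t f D summable_on E"
    unfolding eq by (intro summable_on_add s1 s2 D(1))
  let ?F = "infsum (\<lambda>e. (f e)\<^sup>2) E" and ?S = "infsum (spread f) E" and ?m = "infsum (\<lambda>e. D e * f e) E"
  have S0: "0 \<le> ?S" by (rule infsum_nonneg) (auto simp: E_iff spread_nonneg)
  have F0: "0 \<le> ?F" by (rule infsum_nonneg) simp
  have dis: "(1 - t\<^sup>2) * ?F + t\<^sup>2 * ?S \<le> 2 * ?m"
    by (rule dissipation[OF f _ t(2) fD D(2,1) Df]) (use t in auto)
  have t2: "1 / 4 \<le> t\<^sup>2" using power_mono[OF t(1), of 2] by (simp add: power2_eq_square)
  have t3: "(1 - t)\<^sup>2 \<le> 1 - t\<^sup>2" using t mult_right_mono[of t 1 t] by (simp add: power2_eq_square algebra_simps)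
  have t4: "0 \<le> 1 - t\<^sup>2" using t by (simp add: power_le_one)
  have "1 / 4 * ?S \<le> t\<^sup>2 * ?S" using t2 S0 by (rule mult_right_mono)
  then have S: "?S \<le> 8 * ?m" using dis mult_nonneg_nonneg[OF t4 F0] by linarith
  have "(1 - t)\<^sup>2 * ?F \<le> (1 - t\<^sup>2) * ?F" using t3 F0 by (rule mult_right_mono)
  then have F: "(1 - t)\<^sup>2 * ?F \<le> 2 * ?m"
    using dis mult_nonneg_nonneg[OF zero_le_power2[of t] S0] by linarith
  have "infsum (defect t f D) E = (1 - t)\<^sup>2 * (?F + infsum (\<lambda>(x, y). (avg f x)\<^sup>2) E) + 1 / \<eta> * ?S + infsum D E"
    unfolding eq infsum_add[OF summable_on_add[OF s1 s2] D(1)] infsum_add[OF s1 s2] infsum_cmult_right'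
    by (simp only: infsum_add[OF s avs])
  also have "\<dots> \<le> (1 - t)\<^sup>2 * (?F + ?F) + 1 / \<eta> * (8 * ?m) + infsum D E"
    using av S \<eta>_pos by (intro add_mono mult_left_mono) auto
  also have "\<dots> \<le> (4 + 8 / \<eta>) * ?m + infsum D E"
    using F by (simp add: algebra_simps)
  finally show "infsum (defect t f D) E \<le> (4 + 8 / \<eta>) * infsum (\<lambda>e. D e * f e) E + infsum D E" .
qed

end
end

section \<open>Divergent Green functions\<close>

context edge_walk
begin

lemma avg_nonneg: "x \<in> V \<Longrightarrow> (\<And>e. e \<in> E \<Longrightarrow> 0 \<le> f e) \<Longrightarrow> 0 \<le> avg f x"
  by (auto simp: avg_def E_iff intro!: divide_nonneg_nonneg sum_nonneg)

lemma summable_avg: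
  assumes f: "f summable_on E" "\<And>e. e \<in> E \<Longrightarrow> 0 \<le> f e"
  shows "avg f summable_on V"
proof (rule summable_on_comparison_test)
  have "(\<lambda>x. infsum (\<lambda>y. f (x, y)) (N x)) summable_on V"
    by (rule summable_on_Sigma_banach) (use f(1) in \<open>simp add: E_def\<close>)
  then show "(\<lambda>x. \<Sum>y\<in>N x. f (x, y)) summable_on V"
    by (rule summable_on_cong[THEN iffD1, rotated]) (simp add: finite_N)
next
  fix x assume x: "x \<in> V"
  show "0 \<le> avg f x" by (rule avg_nonneg[OF x f(2)])
  have "0 \<le> (\<Sum>y\<in>N x. f (x, y))" by (intro sum_nonneg f(2)) (simp add: E_iff x)
  then show "avg f x \<le> (\<Sum>y\<in>N x. f (x, y))"
    using card_N_pos[OF x] mult_left_mono[of 1 "real (card (N x))" "\<Sum>y\<in>N x. f (x, y)"]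
    by (simp add: avg_def divide_le_eq)
qed

text \<open>With \<open>D\<close> the indicator of the edges into \<open>v\<close>, the defect bound
  sees \<open>f\<close> only on these edges, where the resolvent equation and
  \<open>sum_T_into\<close> give a total of at most
  \<open>card (N v) * (1 + avg f v)\<close>.\<close>

lemma energy_avg_green_le:
  assumes v: "v \<in> V" and t: "1/2 \<le> t" "t < 1"
  defines "f \<equiv> resolvent UNIV v t"
  shows "energy (avg f) \<le> 32 * (5 + 8 / \<eta>) * card (N v) * (1 + avg f v)"
proof -
  have t': "0 \<le> t" "t \<le> 1" using t by simp_all
  have f: "f summable_on E" "\<And>e. e \<in> E \<Longrightarrow> 0 \<le> f e"
    unfolding f_def using summable_resolvent[OF t'(1) t(2) v] resolvent_nonneg[OF t'(1) t(2) v] by auto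
  define D :: "'a \<times> 'a \<Rightarrow> real" where "D = (\<lambda>(x, y). of_bool (y = v))"
  have D: "D summable_on E" and Dsum: "infsum D E = card (N v)"
    using summable_into[OF v, of "\<lambda>_. 1"] infsum_into[OF v, of "\<lambda>_. 1"] by (simp_all add: D_def)
  have Db: "0 \<le> D e" "D e \<le> 1" for e by (simp_all add: D_def case_prod_unfold)
  have fD: "f e = t * T f e + D e" if "e \<in> E" for e
    using resolvent_eq[OF t'(1) t(2) v, of "fst e" "snd e" UNIV] that
    by (simp add: f_def D_def case_prod_unfold)
  have Df: "(\<lambda>e. D e * f e) summable_on E" and Dfsum: "infsum (\<lambda>e. D e * f e) E = (\<Sum>x\<in>N v. f (x, v))"
    using summable_into[OF v, of f] infsum_into[OF v, of f] by (simp_all add: D_def case_prod_unfold)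
  note A = t(1) t'(2) f D Db fD
  let ?G = "defect t f D"
  have G: "?G summable_on E" by (rule summable_defect[OF A Df])
  have G': "(\<lambda>(x, y). ?G (y, x)) summable_on E" using G by (simp add: summable_swap)
  have w0: "0 \<le> avg f v" by (rule avg_nonneg[OF v f(2)])
  have "(\<Sum>x\<in>N v. f (x, v)) = (\<Sum>x\<in>N v. t * T f (x, v) + 1)"
  proof (rule sum.cong[OF refl])
    fix x assume "x \<in> N v"
    then have "(x, v) \<in> E" using E_sym[of v x] v by (simp add: E_iff)
    from fD[OF this] show "f (x, v) = t * T f (x, v) + 1" by (simp add: D_def)
  qed
  also have "\<dots> = t * (card (N v) * avg f v) + card (N v)"
    by (simp add: sum.distrib sum_distrib_left[symmetric] sum_T_into[OF v] sum_avg[OF v])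
  also have "\<dots> \<le> 1 * (card (N v) * avg f v) + card (N v)"
    using t w0 by (intro add_mono mult_right_mono) auto
  finally have m: "(\<Sum>x\<in>N v. f (x, v)) \<le> card (N v) * (1 + avg f v)" by (simp add: distrib_left)
  have "energy (avg f) \<le> infsum (\<lambda>e. 16 * (?G e + (\<lambda>(x, y). ?G (y, x)) e)) E"
    unfolding energy_def
  proof (rule infsum_le)
    show "(\<lambda>e. 16 * (?G e + (\<lambda>(x, y). ?G (y, x)) e)) summable_on E"
      by (intro summable_on_cmult_right summable_on_add G G')
  qed (use avg_gradient_le[OF A] in auto)
  also have "\<dots> = 32 * infsum ?G E"
    unfolding infsum_cmult_right' infsum_add[OF G G'] infsum_swap by simp
  also have "\<dots> \<le> 32 * ((4 + 8 / \<eta>) * (card (N v) * (1 + avg f v)) + card (N v) * (1 + avg f v))"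
  proof -
    have "infsum ?G E \<le> (4 + 8 / \<eta>) * (\<Sum>x\<in>N v. f (x, v)) + card (N v)"
      using infsum_defect_le[OF A Df] by (simp add: Dfsum Dsum)
    also have "\<dots> \<le> (4 + 8 / \<eta>) * (card (N v) * (1 + avg f v)) + card (N v) * (1 + avg f v)"
      using m w0 \<eta>_pos by (intro add_mono mult_left_mono) (auto simp: distrib_left)
    finally show ?thesis by simp
  qed
  finally show ?thesis by (simp add: algebra_simps add_divide_distrib)
qed

text \<open>The energy of the averages of the Green function grows only linearly in their value at \<open>v\<close>,
  so dividing by that value makes it small.\<close>

lemma small_energy_if_green_diverges:
  assumes v: "v \<in> V" and div: "\<not> summable (\<lambda>n. \<Sum>z\<in>N v. visit UNIV {v} n (v, z))" and \<epsilon>: "0 < \<epsilon>"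
  shows "\<exists>\<phi> :: 'a \<Rightarrow> real. \<phi> v = 1 \<and> \<phi> summable_on V \<and> (\<forall>x\<in>V. 0 \<le> \<phi> x) \<and> energy \<phi> \<le> \<epsilon>"
proof -
  let ?a = "\<lambda>n. \<Sum>z\<in>N v. visit UNIV {v} n (v, z)"
  have vz: "(v, z) \<in> E" if "z \<in> N v" for z using that v by (simp add: E_iff)
  have a0: "0 \<le> ?a n" for n by (intro sum_nonneg visit_nonneg vz)
  define A where "A = 32 * (5 + 8 / \<eta>) * card (N v)"
  have d: "1 \<le> real (card (N v))" using card_N_pos[OF v] by simp
  have A: "0 < A" using \<eta>_pos d by (auto simp: A_def intro!: mult_pos_pos add_pos_pos)
  \<comment> \<open>For \<open>w > B\<close>, the first bound gives \<open>1 + w \<le> 2 * w\<close>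
    and the second makes the normalised energy
    \<open>A * (1 + w) / w\<^sup>2 \<le> 2 * A / w\<close> at most
    \<open>\<epsilon>\<close>.\<close>
  define B where "B = max 1 (2 * A / \<epsilon>)"
  obtain m where m: "2 * card (N v) * B < sum ?a {..<m}"
  proof -
    have "\<not> (\<forall>m. sum ?a {..<m} \<le> 2 * card (N v) * B)"
      using div a0 bounded_imp_summable[of ?a "2 * card (N v) * B"]
      by (metis lessThan_Suc_atMost)
    then show ?thesis using that by (auto simp: not_le)
  qed
  \<comment> \<open>Close enough to 1 that \<open>t ^ m\<close> is at least 1/2 by Bernoulli: the
    discounted sum keeps half of the first \<open>m\<close> terms, which explains the factor 2 in
    the choice of \<open>m\<close>.\<close>
  define t :: real where "t = 1 - 1 / (2 * (m + 1))"
  have t: "1/2 \<le> t" "t < 1" by (auto simp: t_def field_simps)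
  have t0: "0 \<le> t" using t by simp
  have "1/2 \<le> 1 + real m * (t - 1)" by (simp add: t_def field_simps)
  also have "\<dots> \<le> t ^ m" using Bernoulli_inequality[of "t - 1" m] t by simp
  finally have tm: "1/2 \<le> t ^ m" .
  define f where "f = resolvent UNIV v t"
  have f: "f summable_on E" "\<And>e. e \<in> E \<Longrightarrow> 0 \<le> f e"
    unfolding f_def using summable_resolvent[OF t0 t(2) v] resolvent_nonneg[OF t0 t(2) v] by auto
  have "1/2 * sum ?a {..<m} \<le> (\<Sum>n<m. t ^ n * ?a n)"
  proof (subst sum_distrib_left, rule sum_mono)
    fix n assume "n \<in> {..<m}"
    then have "t ^ m \<le> t ^ n" using t t0 by (intro power_decreasing) auto
    with tm have "1/2 \<le> t ^ n" by linarith
    then show "1/2 * ?a n \<le> t ^ n * ?a n" using a0 by (rule mult_right_mono)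
  qed
  also have "\<dots> = (\<Sum>z\<in>N v. \<Sum>n<m. t ^ n * visit UNIV {v} n (v, z))"
    unfolding sum_distrib_left by (rule sum.swap)
  also have "\<dots> \<le> (\<Sum>z\<in>N v. f (v, z))"
    unfolding f_def resolvent_def
    by (intro sum_mono sum_le_suminf summable_resolvent_terms mult_nonneg_nonneg visit_nonneg vz)
      (use t t0 v in auto)
  also have "\<dots> = card (N v) * avg f v" by (rule sum_avg[OF v])
  finally have "card (N v) * B < card (N v) * avg f v" using m by simp
  then have B: "B < avg f v" using d by simp
  define w where "w = avg f v"
  have w: "1 < w" "2 * A / \<epsilon> < w" using B by (simp_all add: B_def w_def)
  have En: "energy (avg f) \<le> A * (1 + w)"
    using energy_avg_green_le[OF v t] by (simp add: A_def f_def w_def)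
  let ?\<phi> = "\<lambda>x. 1 / w * avg f x"
  have "energy ?\<phi> = infsum (\<lambda>e. 1 / w\<^sup>2 * (\<lambda>(x, y). (avg f x - avg f y)\<^sup>2) e) E"
    unfolding energy_def
    by (intro infsum_cong) (auto simp: diff_divide_distrib[symmetric] power_divide)
  also have "\<dots> = 1 / w\<^sup>2 * energy (avg f)" by (simp only: infsum_cmult_right' energy_def)
  also have "\<dots> \<le> 1 / w\<^sup>2 * (A * (w + w))"
    by (rule mult_left_mono[OF order_trans[OF En]]) (use A w in \<open>auto intro!: mult_left_mono\<close>)
  also have "\<dots> = 2 * A / w" using w by (simp add: power2_eq_square field_simps)
  also have "\<dots> \<le> \<epsilon>" using w \<epsilon> by (simp add: field_simps)
  finally have "energy ?\<phi> \<le> \<epsilon>" .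
  moreover have "?\<phi> summable_on V" by (intro summable_on_cmult_right summable_avg f)
  moreover have "0 \<le> ?\<phi> x" if "x \<in> V" for x
    using w avg_nonneg[OF that f(2)] by simp
  moreover have "?\<phi> v = 1" using w by (simp add: w_def)
  ultimately have "?\<phi> v = 1 \<and> ?\<phi> summable_on V \<and> (\<forall>x\<in>V. 0 \<le> ?\<phi> x) \<and> energy ?\<phi> \<le> \<epsilon>"
    by blast
  then show ?thesis by (rule exI[of _ ?\<phi>])
qed

end

section \<open>Return to the starting point\<close>

context edge_walk
begin

lemma T_sum: "T (\<lambda>e. \<Sum>j\<in>J. g j e) e = (\<Sum>j\<in>J. T (g j) e)"
  by (simp add: T_def case_prod_unfold sum_distrib_left sum.swap[of _ J])

text \<open>The hitting time of \<open>v\<close> is either some \<open>j \<le> n\<close> or larger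
  than \<open>n\<close>. The induction step applies \<open>T\<close>, which fixes constants.\<close>

lemma visit_partition:
  "e \<in> E \<Longrightarrow> (\<Sum>j\<le>n. visit (-{v}) {v} j e) + visit (-{v}) (-{v}) n e = 1"
proof (induction n arbitrary: e)
  case 0
  then show ?case by (simp add: case_prod_unfold)
next
  case (Suc n)
  obtain x y where e: "e = (x, y)" by (cases e)
  have xy: "(x, y) \<in> E" using Suc.prems e by simp
  let ?g = "\<lambda>e. (\<Sum>j\<le>n. visit (-{v}) {v} j e) + visit (-{v}) (-{v}) n e"
  have "?g (y, z) = 1" if "z \<in> N y" for z
    by (rule Suc.IH) (use E_sym[OF xy] that in \<open>simp add: E_iff\<close>)
  then have "T ?g (x, y) = T (\<lambda>_. 1) (x, y)" by (simp add: T_def)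
  then have "(\<Sum>j\<le>n. T (visit (-{v}) {v} j) (x, y)) + T (visit (-{v}) (-{v}) n) (x, y) = 1"
    by (simp add: T_add T_sum T_const[OF xy])
  then show ?case unfolding sum.atMost_Suc_shift by (simp add: e)
qed

lemma decseq_escape: "e \<in> E \<Longrightarrow> decseq (\<lambda>n. visit (-{v}) (-{v}) n e)"
proof (rule decseq_SucI)
  fix n assume e: "e \<in> E"
  show "visit (-{v}) (-{v}) (Suc n) e \<le> visit (-{v}) (-{v}) n e"
    using visit_partition[OF e, of v n] visit_partition[OF e, of v "Suc n"]
      visit_nonneg[OF e, of "-{v}" "{v}" "Suc n"] unfolding sum.atMost_Suc by linarith
qed

text \<open>Dropping the powers of \<open>t\<close> leaves the probability of hitting
  \<open>v\<close> by a given time, and \<open>visit_partition\<close> bounds it through the escape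
  probability.\<close>

lemma resolvent_hitting_le:
  assumes t: "0 \<le> t" "t < 1" and v: "v \<in> V" and e: "e \<in> E"
    and \<alpha>: "\<And>n. \<alpha> \<le> visit (-{v}) (-{v}) n e"
  shows "resolvent (-{v}) v t e \<le> 1 - \<alpha>"
  unfolding resolvent_def
proof (rule suminf_le_const[OF summable_resolvent_terms[OF t v e]])
  fix n
  have "(\<Sum>j<n. t ^ j * visit (-{v}) {v} j e) \<le> (\<Sum>j<n. visit (-{v}) {v} j e)"
    using t visit_nonneg[OF e] by (intro sum_mono mult_left_le_one_le power_le_one) auto
  also have "\<dots> \<le> (\<Sum>j\<le>n. visit (-{v}) {v} j e)"
    using visit_nonneg[OF e] by (intro sum_mono2) auto
  also have "\<dots> \<le> 1 - \<alpha>" using visit_partition[OF e, of v n] \<alpha>[of n] by linarith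
  finally show "(\<Sum>j<n. t ^ j * visit (-{v}) {v} j e) \<le> 1 - \<alpha>" .
qed

text \<open>Pairing \<open>\<phi>\<close> with the flow \<open>f (x, y) - f (y, x)\<close>, whose divergence is concentrated at \<open>v\<close>
  up to a term of order \<open>1 - t\<close>.\<close>

lemma return_deficit_le:
  fixes \<phi> :: "'a \<Rightarrow> real"
  assumes v: "v \<in> V" and t: "1/2 \<le> t" "t < 1" and l: "0 < l"
    and \<phi>: "\<phi> v = 1" "\<phi> summable_on V" "\<And>x. x \<in> V \<Longrightarrow> 0 \<le> \<phi> x"
      "\<And>x y. (x, y) \<in> E \<Longrightarrow> \<rho> x = 1 \<Longrightarrow> \<rho> y = 1 \<Longrightarrow> \<phi> x = \<phi> y"
  defines "f \<equiv> resolvent (-{v}) v t"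
  shows "2 * (\<Sum>z\<in>N v. 1 - f (v, z)) \<le>
    2 * (1 - t) * (K * infsum \<phi> V) + 32 * (5 + 8 / \<eta>) * card (N v) * l + energy \<phi> / l"
proof -
  have t': "0 \<le> t" "t \<le> 1" using t by simp_all
  have f: "f summable_on E" "\<And>e. e \<in> E \<Longrightarrow> 0 \<le> f e"
    unfolding f_def using summable_resolvent[OF t'(1) t(2) v] resolvent_nonneg[OF t'(1) t(2) v] by auto
  have f1: "f e \<le> 1" if "e \<in> E" for e
    using resolvent_hitting_le[OF t'(1) t(2) v that, of 0] visit_nonneg[OF that] by (simp add: f_def)
  have Tf: "0 \<le> T f (x, y)" "T f (x, y) \<le> 1" if e: "(x, y) \<in> E" for x y
  proof -
    show "0 \<le> T f (x, y)" by (rule T_nonneg[OF e f(2)])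
    have "T f (x, y) \<le> T (\<lambda>_. 1) (x, y)"
      by (rule T_mono[OF e], rule f1) (use E_sym[OF e] in \<open>simp add: E_iff\<close>)
    then show "T f (x, y) \<le> 1" by (simp add: T_const[OF e])
  qed
  \<comment> \<open>Since \<open>f = 1\<close> on the edges into \<open>v\<close>, this source
    brings \<open>resolvent_eq\<close> to the form \<open>f = t * T f + D\<close>. By
    \<open>sum_T_into\<close> its total is the sum of \<open>1 - t * f (v, z)\<close> over
    \<open>z \<in> N v\<close>, the discounted return deficit.\<close>
  define D where "D = (\<lambda>(x, y). of_bool (y = v) * (1 - t * T f (x, y)))"
  have Db: "0 \<le> D e" "D e \<le> 1" if "e \<in> E" for e
    using Tf[of "fst e" "snd e"] that t' mult_le_one[of t "T f e"]
    by (auto simp: D_def case_prod_unfold)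
  let ?d = "\<lambda>e. 1 - t * T f e"
  have D: "D summable_on E" and Dsum: "infsum D E = (\<Sum>x\<in>N v. ?d (x, v))"
    using summable_into[OF v, of ?d] infsum_into[OF v, of ?d] by (simp_all add: D_def case_prod_unfold)
  have fD: "f e = t * T f e + D e" if "e \<in> E" for e
    using resolvent_eq[OF t'(1) t(2) v, of "fst e" "snd e" "-{v}"] that
    by (auto simp: f_def D_def case_prod_unfold)
  have Df: "(\<lambda>e. D e * f e) summable_on E"
    by (rule summable_le[OF D]) (use Db f f1 in \<open>auto intro: mult_left_le\<close>)
  have Dfsum: "infsum (\<lambda>e. D e * f e) E \<le> infsum D E"
    by (rule infsum_le[OF D]) (use Db f f1 in \<open>auto intro: mult_left_le\<close>)
  have xv: "(x, v) \<in> E" if "x \<in> N v" for x using E_sym[of v x] v that by (simp add: E_iff)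
  have Dd: "infsum D E \<le> card (N v)"
  proof -
    have "(\<Sum>x\<in>N v. ?d (x, v)) \<le> (\<Sum>x\<in>N v. 1)"
      by (rule sum_mono) (use Tf xv t' in auto)
    then show ?thesis by (simp add: Dsum)
  qed
  note A = t(1) t'(2) f D Db fD
  let ?G = "defect t f D"
  have G: "?G summable_on E" by (rule summable_defect[OF A Df])
  have G': "(\<lambda>(x, y). ?G (y, x)) summable_on E" using G by (simp add: summable_swap)
  have Gsum: "infsum ?G E \<le> (5 + 8 / \<eta>) * card (N v)"
  proof -
    have "infsum ?G E \<le> (4 + 8 / \<eta>) * infsum (\<lambda>e. D e * f e) E + infsum D E"
      by (rule infsum_defect_le[OF A Df])
    also have "\<dots> \<le> (4 + 8 / \<eta>) * card (N v) + card (N v)"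
      using Dfsum Dd \<eta>_pos by (intro add_mono mult_left_mono) auto
    finally show ?thesis by (simp add: algebra_simps)
  qed
  define src where "src = (\<lambda>(x, y). \<phi> x * f (x, y))"
  define tgt where "tgt = (\<lambda>(x, y). \<phi> y * f (x, y))"
  let ?src' = "\<lambda>(x, y). src (y, x)" and ?tgt' = "\<lambda>(x, y). tgt (y, x)"
  have \<phi>E: "0 \<le> \<phi> x" "0 \<le> \<phi> y" if "(x, y) \<in> E" for x y
    using that E_sym[OF that] \<phi>(3) by (auto simp: E_iff)
  have src: "src summable_on E"
    by (rule summable_le[OF summable_source[OF \<phi>(2,3)]])
      (use \<phi>E f f1 in \<open>auto simp: src_def intro: mult_left_le\<close>)
  have srcsum: "infsum src E \<le> K * infsum \<phi> V"
    by (rule order_trans[OF infsum_le[OF summable_source[OF \<phi>(2,3)]] infsum_source_le[OF \<phi>(2,3)]])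
      (use \<phi>E f f1 in \<open>auto simp: src_def intro: mult_left_le\<close>)
  have source': "(\<lambda>(x, y). \<phi> y) summable_on E"
    using summable_source[OF \<phi>(2,3)] summable_swap[of "\<lambda>(x, y). \<phi> x"] by simp
  have tgt: "tgt summable_on E"
    by (rule summable_le[OF source'])
      (use \<phi>E f f1 in \<open>auto simp: tgt_def intro: mult_left_le\<close>)
  have src': "?src' summable_on E" and tgt': "?tgt' summable_on E"
    using src tgt by (simp_all only: summable_swap)
  have En: "(\<lambda>(x, y). (\<phi> x - \<phi> y)\<^sup>2) summable_on E" by (rule summable_energy[OF \<phi>(2,3)])
  define \<phi>D where "\<phi>D = (\<lambda>(x, y). of_bool (y = v) * ?d (x, y))"
  have \<phi>D: "\<phi>D summable_on E" "infsum \<phi>D E = infsum D E"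
    using D by (simp_all add: \<phi>D_def D_def)
  have \<phi>D': "(\<lambda>(x, y). \<phi>D (y, x)) summable_on E" using \<phi>D(1) by (simp only: summable_swap)
  \<comment> \<open>Grouping the edges by their heads, \<open>sum_T_into\<close> turns the inflow at
    \<open>x\<close> into \<open>t\<close> times the outflow plus the source; the source sits at
    \<open>v\<close>, where \<open>\<phi>\<close> is 1.\<close>
  have "infsum tgt E = infsum (\<lambda>e. t * src e + (\<lambda>(x, y). \<phi>D (y, x)) e) E"
    unfolding infsum_swap[of tgt, symmetric]
  proof (rule infsum_stars_eq[OF tgt'])
    show "(\<lambda>e. t * src e + (\<lambda>(x, y). \<phi>D (y, x)) e) summable_on E"
      by (intro summable_on_add summable_on_cmult_right src \<phi>D')
    fix x assume x: "x \<in> V"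
    have "(\<Sum>y\<in>N x. ?tgt' (x, y)) = (\<Sum>y\<in>N x. \<phi> x * (t * T f (y, x) + D (y, x)))"
    proof (rule sum.cong[OF refl])
      fix y assume "y \<in> N x"
      then have "(y, x) \<in> E" using E_sym[of x y] x by (simp add: E_iff)
      then show "?tgt' (x, y) = \<phi> x * (t * T f (y, x) + D (y, x))" by (simp add: tgt_def fD)
    qed
    also have "\<dots> = \<phi> x * (t * (\<Sum>y\<in>N x. T f (y, x))) + (\<Sum>y\<in>N x. \<phi> x * D (y, x))"
      by (simp add: sum_distrib_left distrib_left sum.distrib)
    also have "\<dots> = (\<Sum>y\<in>N x. t * src (x, y) + (\<lambda>(x, y). \<phi>D (y, x)) (x, y))"
      unfolding sum_T_into[OF x]
      by (auto simp: sum_distrib_left sum.distrib src_def \<phi>D_def D_def \<phi>(1) intro!: sum.cong)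
    finally show "(\<Sum>y\<in>N x. ?tgt' (x, y)) = (\<Sum>y\<in>N x. t * src (x, y) + (\<lambda>(x, y). \<phi>D (y, x)) (x, y))" .
  qed
  also have "\<dots> = t * infsum src E + infsum D E"
    unfolding infsum_add[OF summable_on_cmult_right[OF src] \<phi>D'] infsum_cmult_right' infsum_swap \<phi>D(2) ..
  finally have flux: "infsum tgt E = t * infsum src E + infsum D E" .
  \<comment> \<open>On the two orientations of an edge, the \<open>tgt\<close> terms exceed the
    \<open>src\<close> terms by minus the product of the gradient of \<open>\<phi>\<close> and the
    flow. A Young inequality with parameter \<open>l\<close> and \<open>flow_sq_le\<close> bound
    this by \<open>?R\<close>.\<close>
  let ?R = "\<lambda>e. 16 * l * (?G e + (\<lambda>(x, y). ?G (y, x)) e) + 1 / l * (\<lambda>(x, y). (\<phi> x - \<phi> y)\<^sup>2) e"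
  have R: "?R summable_on E"
    by (intro summable_on_add summable_on_cmult_right G G' En)
  have "infsum (\<lambda>e. tgt e + ?tgt' e) E \<le> infsum (\<lambda>e. (src e + ?src' e) + ?R e) E"
  proof (rule infsum_mono)
    show "(\<lambda>e. tgt e + ?tgt' e) summable_on E" by (intro summable_on_add tgt tgt')
    show "(\<lambda>e. (src e + ?src' e) + ?R e) summable_on E" by (intro summable_on_add[OF _ R] summable_on_add src src')
    fix e assume "e \<in> E"
    moreover obtain x y where e: "e = (x, y)" by (cases e)
    ultimately have xy: "(x, y) \<in> E" by simp
    let ?g = "\<phi> x - \<phi> y" and ?h = "f (x, y) - f (y, x)"
    have "- (?g * ?h) \<le> 16 * l * (?G (x, y) + ?G (y, x)) + 1 / l * ?g\<^sup>2"
    proof (cases "\<rho> x = 1 \<and> \<rho> y = 1")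
      \<comment> \<open>The flow is not controlled on such an edge, but \<open>\<phi>\<close> is
        constant across it, so the product vanishes.\<close>
      case True
      then have "?g = 0" using \<phi>(4)[OF xy] by simp
      moreover have "0 \<le> l * (?G (x, y) + ?G (y, x))"
        using l defect_ge(1)[OF A xy] defect_ge(1)[OF A E_sym[OF xy]] by simp
      ultimately show ?thesis by simp
    next
      case False
      have "0 \<le> (l * ?h + ?g)\<^sup>2 + (l * ?h)\<^sup>2 + ?g\<^sup>2" by simp
      then have "- (l * (?g * ?h)) \<le> l\<^sup>2 * ?h\<^sup>2 + ?g\<^sup>2"
        by (simp add: power2_eq_square algebra_simps)
      then have "l * (- (?g * ?h)) \<le> l * (l * ?h\<^sup>2 + 1 / l * ?g\<^sup>2)"
        using l by (simp add: power2_eq_square algebra_simps)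
      then have "- (?g * ?h) \<le> l * ?h\<^sup>2 + 1 / l * ?g\<^sup>2"
        using l by (simp only: mult_le_cancel_left_pos)
      also have "\<dots> \<le> l * (16 * (?G (x, y) + ?G (y, x))) + 1 / l * ?g\<^sup>2"
        using flow_sq_le[OF A xy] False l by (intro add_right_mono mult_left_mono) auto
      finally show ?thesis by (simp add: mult_ac)
    qed
    then show "tgt e + ?tgt' e \<le> (src e + ?src' e) + ?R e"
      by (simp add: e src_def tgt_def algebra_simps)
  qed
  moreover have "infsum (\<lambda>e. tgt e + ?tgt' e) E = 2 * infsum tgt E"
    unfolding infsum_add[OF tgt tgt'] infsum_swap by simp
  moreover have "infsum (\<lambda>e. (src e + ?src' e) + ?R e) E = 2 * infsum src E + infsum ?R E"
    unfolding infsum_add[OF summable_on_add[OF src src'] R] infsum_add[OF src src'] infsum_swap by simp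
  moreover have "infsum ?R E = 16 * l * (2 * infsum ?G E) + 1 / l * energy \<phi>"
    unfolding infsum_add[OF summable_on_cmult_right[OF summable_on_add[OF G G']] summable_on_cmult_right[OF En]]
      infsum_cmult_right' infsum_add[OF G G'] infsum_swap energy_def by simp
  ultimately have "2 * infsum D E \<le> 2 * (1 - t) * infsum src E + 32 * l * infsum ?G E + energy \<phi> / l"
    unfolding flux by (simp add: algebra_simps)
  also have "\<dots> \<le> 2 * (1 - t) * (K * infsum \<phi> V) + 32 * l * ((5 + 8 / \<eta>) * card (N v)) + energy \<phi> / l"
    using srcsum Gsum t l by (intro add_mono mult_left_mono) auto
  finally have main: "2 * infsum D E \<le>
      2 * (1 - t) * (K * infsum \<phi> V) + 32 * l * ((5 + 8 / \<eta>) * card (N v)) + energy \<phi> / l" .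
  have "(\<Sum>z\<in>N v. 1 - f (v, z)) \<le> (\<Sum>z\<in>N v. 1 - t * f (v, z))"
    by (rule sum_mono) (use f t' v in \<open>auto simp: E_iff intro: mult_left_le_one_le\<close>)
  also have "\<dots> = infsum D E"
    unfolding Dsum using sum_T_into[OF v, of f] by (simp add: sum_subtractf sum_distrib_left[symmetric])
  finally show ?thesis using main by (simp add: mult_ac)
qed

text \<open>The order of limits matters: \<open>\<phi>\<close> is chosen first, with energy at most
  \<open>l * l\<close>; then \<open>t\<close> tends to 1, which removes the term containing
  \<open>infsum \<phi> V\<close>; only then does \<open>l\<close> tend to 0.\<close>

lemma escape_vanishes:
  assumes v: "v \<in> V"
    and test: "\<And>\<epsilon>. 0 < \<epsilon> \<Longrightarrow> \<exists>\<phi> :: 'a \<Rightarrow> real. \<phi> v = 1 \<and> \<phi> summable_on V \<and> (\<forall>x\<in>V. 0 \<le> \<phi> x) \<and>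
      (\<forall>x y. (x, y) \<in> E \<longrightarrow> \<rho> x = 1 \<longrightarrow> \<rho> y = 1 \<longrightarrow> \<phi> x = \<phi> y) \<and> energy \<phi> \<le> \<epsilon>"
    and z: "z \<in> N v"
  shows "(\<lambda>n. visit (-{v}) (-{v}) n (v, z)) \<longlonglongrightarrow> 0"
proof -
  let ?a = "visit (-{v}) (-{v})"
  have vz: "(v, z) \<in> E" if "z \<in> N v" for z using that v by (simp add: E_iff)
  define \<alpha> where "\<alpha> z = lim (\<lambda>n. ?a n (v, z))" for z
  have \<alpha>: "(\<lambda>n. ?a n (v, z)) \<longlonglongrightarrow> \<alpha> z" "\<And>n. \<alpha> z \<le> ?a n (v, z)" "0 \<le> \<alpha> z" if "z \<in> N v" for z
  proof -
    have "\<forall>n. 0 \<le> ?a n (v, z)" using visit_nonneg[OF vz[OF that]] by blast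
    from decseq_convergent[OF decseq_escape[OF vz[OF that]] this] obtain L where
      L: "(\<lambda>n. ?a n (v, z)) \<longlonglongrightarrow> L" "\<forall>n. L \<le> ?a n (v, z)" .
    then have "\<alpha> z = L" by (simp add: \<alpha>_def limI)
    with L show "(\<lambda>n. ?a n (v, z)) \<longlonglongrightarrow> \<alpha> z" "\<And>n. \<alpha> z \<le> ?a n (v, z)" by auto
    show "0 \<le> \<alpha> z"
      using L(1) unfolding \<open>\<alpha> z = L\<close>
      by (rule LIMSEQ_le_const) (simp add: visit_nonneg[OF vz[OF that]])
  qed
  define C where "C = 32 * (5 + 8 / \<eta>) * card (N v) + 1"
  have "0 \<le> 32 * (5 + 8 / \<eta>) * card (N v)" using \<eta>_pos by (intro mult_nonneg_nonneg) auto
  then have C: "0 < C" unfolding C_def by linarith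
  have bound: "2 * sum \<alpha> (N v) \<le> C * l" if l: "0 < l" for l
  proof -
    obtain \<phi> where \<phi>: "\<phi> v = 1" "\<phi> summable_on V" "\<And>x. x \<in> V \<Longrightarrow> 0 \<le> \<phi> x"
      "\<And>x y. (x, y) \<in> E \<Longrightarrow> \<rho> x = 1 \<Longrightarrow> \<rho> y = 1 \<Longrightarrow> \<phi> x = \<phi> y" "energy \<phi> \<le> l * l"
      using test[OF mult_pos_pos[OF l l]] by auto
    have en: "energy \<phi> / l \<le> l" using \<phi>(5) l by (simp add: field_simps)
    let ?P = "K * infsum \<phi> V"
    have "2 * sum \<alpha> (N v) \<le> 2 * (1 - t) * ?P + C * l" if t: "1/2 \<le> t" "t < 1" for t
    proof -
      have t0: "0 \<le> t" using t by simp
      have "sum \<alpha> (N v) \<le> (\<Sum>z\<in>N v. 1 - resolvent (-{v}) v t (v, z))"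
      proof (rule sum_mono)
        fix z assume z: "z \<in> N v"
        show "\<alpha> z \<le> 1 - resolvent (-{v}) v t (v, z)"
          using resolvent_hitting_le[OF t0 t(2) v vz[OF z], OF \<alpha>(2)[OF z]] by simp
      qed
      then show ?thesis
        using return_deficit_le[OF v t l \<phi>(1-4)] en unfolding C_def distrib_right by linarith
    qed
    then have "eventually (\<lambda>t. 2 * sum \<alpha> (N v) \<le> 2 * (1 - t) * ?P + C * l) (at_left 1)"
      unfolding eventually_at_left[OF zero_less_one] by (intro exI[of _ "1/2"]) auto
    moreover have "((\<lambda>t. 2 * (1 - t) * ?P + C * l) \<longlongrightarrow> 2 * (1 - 1) * ?P + C * l) (at_left 1)"
      by (intro tendsto_intros)
    ultimately show ?thesis
      using tendsto_lowerbound[of "\<lambda>t. 2 * (1 - t) * ?P + C * l" _ "at_left 1" "2 * sum \<alpha> (N v)"]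
      by simp
  qed
  have "2 * sum \<alpha> (N v) \<le> 0 + \<epsilon>" if "0 < \<epsilon>" for \<epsilon>
    using bound[of "\<epsilon> / C"] that C by simp
  then have "2 * sum \<alpha> (N v) \<le> 0" by (rule field_le_epsilon)
  then have "\<alpha> z = 0"
    using member_le_sum[OF z _ finite_N[OF v], of \<alpha>] \<alpha>(3) z by (simp add: order_antisym)
  then show ?thesis using \<alpha>(1)[OF z] by simp
qed

end

section \<open>Contracting short paths\<close>

lemma relpow_subset: "R \<subseteq> S \<Longrightarrow> R ^^ n \<subseteq> S ^^ n" for R S :: "('a \<times> 'a) set"
  by (induction n) auto

context bounded_degree_graph
begin

text \<open>\<open>path_energy\<close> and \<open>ball_sum\<close> dominate the squared increments and the values of \<open>\<phi>\<close>
  along all walks of length at most \<open>m\<close> from a vertex.\<close>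

primrec path_energy :: "('a \<Rightarrow> real) \<Rightarrow> nat \<Rightarrow> 'a \<Rightarrow> real" where
  "path_energy \<phi> 0 = (\<lambda>x. 0)"
| "path_energy \<phi> (Suc m) = (\<lambda>x. 2 * (\<Sum>y\<in>N x. (\<phi> x - \<phi> y)\<^sup>2) + 2 * (\<Sum>y\<in>N x. path_energy \<phi> m y))"

primrec ball_sum :: "('a \<Rightarrow> real) \<Rightarrow> nat \<Rightarrow> 'a \<Rightarrow> real" where
  "ball_sum \<phi> 0 = \<phi>"
| "ball_sum \<phi> (Suc m) = (\<lambda>x. \<phi> x + (\<Sum>y\<in>N x. ball_sum \<phi> m y))"

primrec path_const :: "nat \<Rightarrow> real" where
  "path_const 0 = 0"
| "path_const (Suc m) = 2 + 2 * K * path_const m"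

lemma path_const_nonneg: "0 \<le> path_const m"
  by (induction m) auto

lemma path_energy_nonneg: "x \<in> V \<Longrightarrow> 0 \<le> path_energy \<phi> m x"
proof (induction m arbitrary: x)
  case (Suc m)
  have "0 \<le> (\<Sum>y\<in>N x. path_energy \<phi> m y)"
    using N_subset[OF Suc.prems] by (intro sum_nonneg Suc.IH) auto
  then show ?case by (simp add: sum_nonneg)
qed simp

lemma energy_eq_stars:
  fixes \<phi> :: "'a \<Rightarrow> real"
  assumes "\<phi> summable_on V" "\<And>x. x \<in> V \<Longrightarrow> 0 \<le> \<phi> x"
  shows "(\<lambda>x. \<Sum>y\<in>N x. (\<phi> x - \<phi> y)\<^sup>2) summable_on V"
    and "energy \<phi> = (\<Sum>\<^sub>\<infinity>x\<in>V. \<Sum>y\<in>N x. (\<phi> x - \<phi> y)\<^sup>2)"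
proof -
  note s = summable_energy[OF assms]
  show "energy \<phi> = (\<Sum>\<^sub>\<infinity>x\<in>V. \<Sum>y\<in>N x. (\<phi> x - \<phi> y)\<^sup>2)"
    unfolding energy_def by (subst infsum_stars[OF s]) simp_all
  have "(\<lambda>x. infsum (\<lambda>y. (\<phi> x - \<phi> y)\<^sup>2) (N x)) summable_on V"
    using summable_on_Sigma_banach[OF s[unfolded E_def]] by simp
  then show "(\<lambda>x. \<Sum>y\<in>N x. (\<phi> x - \<phi> y)\<^sup>2) summable_on V"
    by (rule summable_on_cong[THEN iffD1, rotated]) (simp add: finite_N)
qed

lemma
  assumes \<phi>: "\<phi> summable_on V" "\<And>x. x \<in> V \<Longrightarrow> 0 \<le> \<phi> x"
  shows summable_path_energy: "path_energy \<phi> m summable_on V"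
    and infsum_path_energy_le: "infsum (path_energy \<phi> m) V \<le> path_const m * energy \<phi>"
proof (induction m)
  case 0
  case 1 show ?case by simp
  case 2 show ?case by simp
next
  case (Suc m)
  have e: "(\<lambda>x. \<Sum>y\<in>N x. (\<phi> x - \<phi> y)\<^sup>2) summable_on V"
    "energy \<phi> = (\<Sum>\<^sub>\<infinity>x\<in>V. \<Sum>y\<in>N x. (\<phi> x - \<phi> y)\<^sup>2)"
    by (rule energy_eq_stars[OF \<phi>]; assumption)+
  note s = summable_nbr_sum[OF Suc(1) path_energy_nonneg] and le = infsum_nbr_sum_le[OF Suc(1) path_energy_nonneg]
  case 1 show ?case
    unfolding path_energy.simps by (intro summable_on_add summable_on_cmult_right e s)
  have "infsum (path_energy \<phi> (Suc m)) V =
      2 * energy \<phi> + 2 * (\<Sum>\<^sub>\<infinity>x\<in>V. \<Sum>y\<in>N x. path_energy \<phi> m y)"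
    unfolding path_energy.simps e(2)
    by (simp only: infsum_add[OF summable_on_cmult_right[OF e(1)] summable_on_cmult_right[OF s]] infsum_cmult_right')
  also have "\<dots> \<le> 2 * energy \<phi> + 2 * (K * (path_const m * energy \<phi>))"
    using le Suc(2) by (intro add_left_mono mult_left_mono order_trans[OF le]) auto
  finally have "infsum (path_energy \<phi> (Suc m)) V \<le> 2 * energy \<phi> + 2 * (K * (path_const m * energy \<phi>))" .
  moreover case 2
  ultimately show ?case by (simp add: algebra_simps)
qed

text \<open>Splitting off the first step of the walk and squaring the sum of two increments costs
  the factors 2 in \<open>path_energy\<close>.\<close>

lemma path_energy_ge:
  "x \<in> V \<Longrightarrow> j \<le> m \<Longrightarrow> (x, y) \<in> E ^^ j \<Longrightarrow> (\<phi> x - \<phi> y)\<^sup>2 \<le> path_energy \<phi> m x"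
proof (induction m arbitrary: x j)
  case (Suc m)
  show ?case
  proof (cases j)
    case 0
    then show ?thesis using Suc.prems path_energy_nonneg[of x \<phi> "Suc m"] by simp
  next
    case (Suc i)
    from Suc.prems(3) obtain z where z: "(x, z) \<in> E" "(z, y) \<in> E ^^ i"
      unfolding Suc by (rule relpow_Suc_E2)
    have zN: "z \<in> N x" and zV: "z \<in> V" using z(1) N_subset[OF Suc.prems(1)] by (auto simp: E_iff)
    have IH: "(\<phi> z - \<phi> y)\<^sup>2 \<le> path_energy \<phi> m z"
      using Suc.IH[OF zV _ z(2)] Suc.prems(2) Suc by simp
    have f: "finite (N x)" by (rule finite_N[OF Suc.prems(1)])
    have 1: "(\<phi> x - \<phi> z)\<^sup>2 \<le> (\<Sum>y\<in>N x. (\<phi> x - \<phi> y)\<^sup>2)"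
      by (rule member_le_sum[OF zN _ f]) simp
    have 2: "path_energy \<phi> m z \<le> (\<Sum>y\<in>N x. path_energy \<phi> m y)"
      by (rule member_le_sum[OF zN _ f]) (use N_subset[OF Suc.prems(1)] path_energy_nonneg in auto)
    have "0 \<le> ((\<phi> x - \<phi> z) - (\<phi> z - \<phi> y))\<^sup>2" by simp
    then have "(\<phi> x - \<phi> y)\<^sup>2 \<le> 2 * (\<phi> x - \<phi> z)\<^sup>2 + 2 * (\<phi> z - \<phi> y)\<^sup>2"
      by (simp add: power2_eq_square algebra_simps)
    with 1 2 IH show ?thesis unfolding path_energy.simps by linarith
  qed
qed simp

lemma ball_sum_nonneg: "x \<in> V \<Longrightarrow> (\<And>x. x \<in> V \<Longrightarrow> 0 \<le> \<phi> x) \<Longrightarrow> 0 \<le> ball_sum \<phi> m x"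
proof (induction m arbitrary: x)
  case (Suc m)
  have "0 \<le> (\<Sum>y\<in>N x. ball_sum \<phi> m y)"
    using N_subset[OF Suc.prems(1)] by (intro sum_nonneg Suc.IH Suc.prems(2)) auto
  then show ?case using Suc.prems by simp
qed simp

lemma summable_ball_sum:
  assumes \<phi>: "\<phi> summable_on V" "\<And>x. x \<in> V \<Longrightarrow> 0 \<le> \<phi> x"
  shows "ball_sum \<phi> m summable_on V"
proof (induction m)
  case (Suc m)
  then show ?case
    unfolding ball_sum.simps
    by (intro summable_on_add \<phi>(1) summable_nbr_sum ball_sum_nonneg \<phi>(2))
qed (simp add: \<phi>)

lemma ball_sum_ge:
  assumes \<phi>: "\<And>x. x \<in> V \<Longrightarrow> 0 \<le> \<phi> x"
  shows "x \<in> V \<Longrightarrow> j \<le> m \<Longrightarrow> (x, y) \<in> E ^^ j \<Longrightarrow> \<phi> y \<le> ball_sum \<phi> m x"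
proof (induction m arbitrary: x j)
  case (Suc m)
  have nn: "0 \<le> ball_sum \<phi> m z" if "z \<in> N x" for z
    by (rule ball_sum_nonneg) (use that N_subset[OF Suc.prems(1)] \<phi> in auto)
  show ?case
  proof (cases j)
    case 0
    then show ?thesis using Suc.prems nn by (simp add: sum_nonneg)
  next
    case (Suc i)
    from Suc.prems(3) obtain z where z: "(x, z) \<in> E" "(z, y) \<in> E ^^ i"
      unfolding Suc by (rule relpow_Suc_E2)
    have zN: "z \<in> N x" and zV: "z \<in> V" using z(1) N_subset[OF Suc.prems(1)] by (auto simp: E_iff)
    have "\<phi> y \<le> ball_sum \<phi> m z"
      using Suc.IH[OF zV _ z(2)] Suc.prems(2) Suc by simp
    also have "\<dots> \<le> (\<Sum>y\<in>N x. ball_sum \<phi> m y)"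
      by (rule member_le_sum[OF zN _ finite_N[OF Suc.prems(1)]]) (use nn in auto)
    finally show ?thesis using \<phi>[OF Suc.prems(1)] by simp
  qed
qed simp

text \<open>Each class of \<open>R\<^sup>*\<close> receives the value of \<open>\<phi>\<close> at
  one representative, at most \<open>m\<close> steps from every member. An increment across an edge
  then splits into the old one and two increments towards representatives, which
  \<open>path_energy\<close> dominates.\<close>

lemma contract_energy:
  fixes \<phi> :: "'a \<Rightarrow> real"
  assumes v: "v \<in> V" and R: "R \<subseteq> E" "sym R"
    and short: "\<And>x y. (x, y) \<in> R\<^sup>* \<Longrightarrow> \<exists>j\<le>m. (x, y) \<in> R ^^ j"
    and \<phi>: "\<phi> v = 1" "\<phi> summable_on V" "\<And>x. x \<in> V \<Longrightarrow> 0 \<le> \<phi> x"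
  shows "\<exists>\<psi> :: 'a \<Rightarrow> real. \<psi> v = 1 \<and> \<psi> summable_on V \<and> (\<forall>x\<in>V. 0 \<le> \<psi> x) \<and>
    (\<forall>x y. (x, y) \<in> R \<longrightarrow> \<psi> x = \<psi> y) \<and> energy \<psi> \<le> (6 * K * path_const m + 3) * energy \<phi>"
proof -
  \<comment> \<open>The class of \<open>v\<close> is represented by \<open>v\<close> itself, so that
    the normalisation at \<open>v\<close> survives.\<close>
  define rep where "rep x = (if (x, v) \<in> R\<^sup>* then v else SOME y. (x, y) \<in> R\<^sup>*)" for x
  let ?\<psi> = "\<lambda>x. \<phi> (rep x)"
  have rep: "(x, rep x) \<in> R\<^sup>*" for x
    unfolding rep_def using someI[of "\<lambda>y. (x, y) \<in> R\<^sup>*" x] by auto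
  have near: "\<exists>j\<le>m. (x, rep x) \<in> E ^^ j" for x
    using short[OF rep[of x]] relpow_subset[OF R(1)] by blast
  \<comment> \<open>By symmetry of \<open>R\<close>, related vertices reach the same set, so
    \<open>SOME\<close> selects the same representative for both.\<close>
  have const: "rep x = rep y" if "(x, y) \<in> R" for x y
  proof -
    have "(y, x) \<in> R" using R(2) that by (simp add: symD)
    then have "(x, z) \<in> R\<^sup>* \<longleftrightarrow> (y, z) \<in> R\<^sup>*" for z
      using that by (meson converse_rtrancl_into_rtrancl)
    then show ?thesis by (simp add: rep_def)
  qed
  have repV: "rep x \<in> V" if x: "x \<in> V" for x
    using rep[of x]
  proof (induction rule: rtrancl_induct)
    case (step y z)
    then have "(y, z) \<in> E" using R(1) by blast
    then show ?case using N_subset[OF step.IH] by (auto simp: E_iff)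
  qed (rule x)
  have s: "?\<psi> summable_on V"
  proof (rule summable_on_comparison_test[OF summable_ball_sum[OF \<phi>(2,3), of m]])
    fix x assume x: "x \<in> V"
    then show "0 \<le> ?\<psi> x" by (intro \<phi>(3) repV)
    from near[of x] show "?\<psi> x \<le> ball_sum \<phi> m x"
      using ball_sum_ge[of \<phi>, OF \<phi>(3) x] by blast
  qed
  have nn: "0 \<le> ?\<psi> x" if "x \<in> V" for x by (rule \<phi>(3)[OF repV[OF that]])
  let ?U = "path_energy \<phi> m"
  have U: "?U summable_on V" by (rule summable_path_energy[OF \<phi>(2,3)])
  have Us: "(\<lambda>(x, y). ?U x) summable_on E" by (rule summable_source[OF U path_energy_nonneg])
  note Ule = infsum_source_le[OF U path_energy_nonneg]
  have Us': "(\<lambda>(x, y). ?U y) summable_on E" and Ule': "infsum (\<lambda>(x, y). ?U y) E = infsum (\<lambda>(x, y). ?U x) E"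
    using Us summable_swap[of "\<lambda>(x, y). ?U x"] infsum_swap[of "\<lambda>(x, y). ?U x"] by simp_all
  have En: "(\<lambda>(x, y). (\<phi> x - \<phi> y)\<^sup>2) summable_on E" by (rule summable_energy[OF \<phi>(2,3)])
  let ?B = "\<lambda>e. 3 * (((\<lambda>(x, y). ?U x) e + (\<lambda>(x, y). ?U y) e) + (\<lambda>(x, y). (\<phi> x - \<phi> y)\<^sup>2) e)"
  have "energy ?\<psi> \<le> infsum ?B E"
    unfolding energy_def
  proof (rule infsum_le)
    show "?B summable_on E" by (intro summable_on_cmult_right summable_on_add Us Us' En)
    fix x y assume xy: "(x, y) \<in> E"
    have xV: "x \<in> V" "y \<in> V" using xy E_sym[OF xy] by (auto simp: E_iff)
    obtain i j where ij: "i \<le> m" "(x, rep x) \<in> E ^^ i" "j \<le> m" "(y, rep y) \<in> E ^^ j"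
      using near[of x] near[of y] by blast
    let ?a = "\<phi> (rep x) - \<phi> x" and ?b = "\<phi> x - \<phi> y" and ?c = "\<phi> y - \<phi> (rep y)"
    have "0 \<le> (?a - ?b)\<^sup>2 + (?b - ?c)\<^sup>2 + (?a - ?c)\<^sup>2" by simp
    then have "(?\<psi> x - ?\<psi> y)\<^sup>2 \<le> 3 * ((?a\<^sup>2 + ?c\<^sup>2) + ?b\<^sup>2)"
      by (simp add: power2_eq_square algebra_simps)
    also have "\<dots> \<le> 3 * ((?U x + ?U y) + ?b\<^sup>2)"
      using path_energy_ge[OF xV(1) ij(1,2), of \<phi>] path_energy_ge[OF xV(2) ij(3,4), of \<phi>]
      by (simp add: power2_commute[of "\<phi> x" "\<phi> (rep x)"])
    finally show "(\<lambda>(x, y). (?\<psi> x - ?\<psi> y)\<^sup>2) (x, y) \<le> ?B (x, y)" by simp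
  qed auto
  also have "\<dots> = 3 * ((infsum (\<lambda>(x, y). ?U x) E + infsum (\<lambda>(x, y). ?U x) E) + energy \<phi>)"
    by (simp only: infsum_cmult_right' infsum_add[OF summable_on_add[OF Us Us'] En] infsum_add[OF Us Us'] Ule' energy_def)
  also have "\<dots> \<le> 3 * ((K * (path_const m * energy \<phi>) + K * (path_const m * energy \<phi>)) + energy \<phi>)"
    using Ule infsum_path_energy_le[OF \<phi>(2,3), of m]
    by (intro mult_left_mono add_mono order_trans[OF Ule] order_refl) auto
  also have "\<dots> = (6 * K * path_const m + 3) * energy \<phi>" by (simp add: algebra_simps)
  finally have "energy ?\<psi> \<le> (6 * K * path_const m + 3) * energy \<phi>" .
  moreover have "?\<psi> v = 1" by (simp add: rep_def \<phi>(1))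
  moreover have "\<forall>x y. (x, y) \<in> R \<longrightarrow> ?\<psi> x = ?\<psi> y" using const by metis
  ultimately show ?thesis using s nn by (intro exI[of _ ?\<psi>] conjI ballI) auto
qed

end

text \<open>Loop erasure: if the new first vertex already lies on the path, the part before that
  occurrence is cut off. The \<open>insert y\<close> covers the one-vertex path when
  \<open>y\<close> is outside \<open>Field R\<close>.\<close>

lemma rtrancl_imp_vpath:
  assumes "(x, y) \<in> R\<^sup>*"
  shows "\<exists>p. p \<noteq> [] \<and> hd p = x \<and> last p = y \<and> distinct p \<and> set p \<subseteq> insert y (Field R) \<and> set (vwalk_arcs p) \<subseteq> R"
  using assms
proof (induction rule: converse_rtrancl_induct)
  case base
  show ?case by (intro exI[of _ "[y]"]) simp
next
  case (step x z)
  then obtain p where p: "p \<noteq> []" "hd p = z" "last p = y" "distinct p"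
    "set p \<subseteq> insert y (Field R)" "set (vwalk_arcs p) \<subseteq> R" by blast
  show ?case
  proof (cases "x \<in> set p")
    case True
    then obtain q r where q: "p = q @ x # r" by (meson split_list)
    show ?thesis
      by (rule exI[of _ "x # r"]) (use p q set_vwalk_arcs_append2[of "x # r" q] in auto)
  next
    case False
    have "x \<in> Field R" using step.hyps(1) by (simp add: FieldI1)
    then show ?thesis
      by (intro exI[of _ "x # p"]) (use p step.hyps(1) False in simp)
  qed
qed

lemma vwalk_arcs_imp_relpow:
  "p \<noteq> [] \<Longrightarrow> set (vwalk_arcs p) \<subseteq> R \<Longrightarrow> (hd p, last p) \<in> R ^^ (length p - 1)"
proof (induction p rule: vwalk_arcs.induct)
  case (3 x y p)
  then have "(x, y) \<in> R" "(y, last (y # p)) \<in> R ^^ length p" by auto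
  then have "(x, last (y # p)) \<in> R ^^ Suc (length p)" by (rule relpow_Suc_I2)
  then show ?case by simp
qed simp_all

section \<open>Walks as random processes\<close>

locale walk_process = edge_walk V N K \<rho> \<eta>
  for V :: "'a set" and N :: "'a \<Rightarrow> 'a set" and K :: nat and \<rho> :: "'a \<Rightarrow> real" and \<eta> :: real +
  fixes p :: "nat \<Rightarrow> (nat \<Rightarrow> 'a) \<Rightarrow> 'a \<Rightarrow> real" and v :: 'a and M :: "'b measure" and X :: "nat \<Rightarrow> 'b \<Rightarrow> 'a"
  assumes process: "process_with_transitions V p v M X"
    and start: "v \<in> V"
    and p_0: "\<And>x y. p 0 x y = (if y \<in> N (x 0) then 1 / card (N (x 0)) else 0)"
    and p_Suc: "\<And>n x y. p (Suc n) x y = (if y \<in> N (x (Suc n)) then ker (x n) (x (Suc n)) y else 0)"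
begin

sublocale prob_space M
  using process by (simp add: process_with_transitions_def)

lemma X_measurable [measurable]: "X n \<in> measurable M (count_space UNIV)"
proof -
  have "X n \<in> measurable M (count_space V)"
    using process by (simp add: process_with_transitions_def)
  then show ?thesis by (rule measurable_compose) simp
qed

lemma pred_X [measurable]: "Measurable.pred M (\<lambda>\<omega>. X n \<omega> \<in> S)"
  by (rule measurable_compose[OF X_measurable]) simp

lemma X_in_V: "\<omega> \<in> space M \<Longrightarrow> X n \<omega> \<in> V"
proof -
  have "X n \<in> measurable M (count_space V)"
    using process by (simp add: process_with_transitions_def)
  then show "\<omega> \<in> space M \<Longrightarrow> X n \<omega> \<in> V" by (auto dest: measurable_space)
qed

lemma AE_X_0: "AE \<omega> in M. X 0 \<omega> = v"
  using process by (simp add: process_with_transitions_def)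

section \<open>Probabilities of finite histories\<close>

lemma prob_mono:
  assumes "Measurable.pred M Q" "\<And>\<omega>. \<omega> \<in> space M \<Longrightarrow> P \<omega> \<Longrightarrow> Q \<omega>"
  shows "\<P>(\<omega> in M. P \<omega>) \<le> \<P>(\<omega> in M. Q \<omega>)"
  by (rule finite_measure_mono) (use assms in auto)

text \<open>Multiplying out the conditional probability extends the transition rule to null
  histories, for which both sides are 0.\<close>

lemma prob_step:
  "\<P>(\<omega> in M. X (Suc n) \<omega> = y \<and> (\<forall>i\<le>n. X i \<omega> = x i)) = \<P>(\<omega> in M. \<forall>i\<le>n. X i \<omega> = x i) * p n x y"
proof (cases "\<P>(\<omega> in M. \<forall>i\<le>n. X i \<omega> = x i) > 0")
  case True
  then have "\<P>(\<omega> in M. X (Suc n) \<omega> = y \<bar> \<forall>i\<le>n. X i \<omega> = x i) = p n x y"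
    using process by (simp add: process_with_transitions_def)
  then show ?thesis using True by (simp add: cond_prob_def field_simps)
next
  case False
  then have 0: "\<P>(\<omega> in M. \<forall>i\<le>n. X i \<omega> = x i) = 0" by (simp add: order_antisym not_less)
  have "\<P>(\<omega> in M. X (Suc n) \<omega> = y \<and> (\<forall>i\<le>n. X i \<omega> = x i)) \<le> \<P>(\<omega> in M. \<forall>i\<le>n. X i \<omega> = x i)"
    by (rule prob_mono) auto
  then show ?thesis using 0 by (simp add: measure_le_0_iff)
qed

lemma prob_history_Suc:
  "\<P>(\<omega> in M. \<forall>i\<le>Suc n. X i \<omega> = x i) = \<P>(\<omega> in M. \<forall>i\<le>n. X i \<omega> = x i) * p n x (x (Suc n))"
proof -
  have "(\<forall>i\<le>Suc n. X i \<omega> = x i) \<longleftrightarrow> X (Suc n) \<omega> = x (Suc n) \<and> (\<forall>i\<le>n. X i \<omega> = x i)" for \<omega>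
    by (auto simp: le_Suc_eq)
  then show ?thesis using prob_step[of n "x (Suc n)" x] by simp
qed

lemma history_in_V: "0 < \<P>(\<omega> in M. \<forall>i\<le>n. X i \<omega> = x i) \<Longrightarrow> i \<le> n \<Longrightarrow> x i \<in> V"
proof -
  assume "0 < \<P>(\<omega> in M. \<forall>i\<le>n. X i \<omega> = x i)" and i: "i \<le> n"
  then have "{\<omega> \<in> space M. \<forall>i\<le>n. X i \<omega> = x i} \<noteq> {}" by force
  then obtain \<omega> where "\<omega> \<in> space M" "X i \<omega> = x i" using i by blast
  then show "x i \<in> V" using X_in_V by metis
qed

lemma history_edge: "0 < \<P>(\<omega> in M. \<forall>i\<le>Suc n. X i \<omega> = x i) \<Longrightarrow> (x n, x (Suc n)) \<in> E"
proof -
  assume pos: "0 < \<P>(\<omega> in M. \<forall>i\<le>Suc n. X i \<omega> = x i)"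
  then have "p n x (x (Suc n)) \<noteq> 0" by (auto simp: prob_history_Suc)
  then have "x (Suc n) \<in> N (x n)" by (cases n) (auto simp: p_0 p_Suc split: if_splits)
  then show ?thesis using history_in_V[OF pos, of n] by (simp add: E_iff)
qed

text \<open>After a history of positive probability the transition probabilities to the neighbours
  already sum to 1, which leaves no mass for other vertices.\<close>

lemma AE_step: "AE \<omega> in M. (\<forall>i\<le>n. X i \<omega> = x i) \<longrightarrow> X (Suc n) \<omega> \<in> N (x n)"
proof (cases "0 < \<P>(\<omega> in M. \<forall>i\<le>n. X i \<omega> = x i)")
  case True
  let ?H = "\<lambda>\<omega>. \<forall>i\<le>n. X i \<omega> = x i"
  have V: "x n \<in> V" by (rule history_in_V[OF True]) simp
  have "(\<Sum>y\<in>N (x n). p n x y) = 1"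
  proof (cases n)
    case 0
    then show ?thesis using card_N_pos[OF V] by (simp add: p_0)
  next
    case (Suc m)
    then show ?thesis using sum_ker[OF history_edge[of m x]] True by (simp add: p_Suc)
  qed
  then have "\<P>(\<omega> in M. ?H \<omega>) = (\<Sum>y\<in>N (x n). \<P>(\<omega> in M. X (Suc n) \<omega> = y \<and> ?H \<omega>))"
    unfolding prob_step by (simp add: sum_distrib_left[symmetric])
  also have "\<dots> = \<P>(\<omega> in M. X (Suc n) \<omega> \<in> N (x n) \<and> ?H \<omega>)"
  proof (rule prob_sum[symmetric])
    show "finite (N (x n))" by (rule finite_N[OF V])
  qed (measurable, auto)
  finally have "\<P>(\<omega> in M. ?H \<omega>) = \<P>(\<omega> in M. X (Suc n) \<omega> \<in> N (x n) \<and> ?H \<omega>)" .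
  moreover have "\<P>(\<omega> in M. ?H \<omega>) =
      \<P>(\<omega> in M. X (Suc n) \<omega> \<in> N (x n) \<and> ?H \<omega>) + \<P>(\<omega> in M. X (Suc n) \<omega> \<notin> N (x n) \<and> ?H \<omega>)"
    by (subst finite_measure_Union[symmetric]) (auto intro!: arg_cong[where f = "measure M"])
  ultimately have "\<P>(\<omega> in M. X (Suc n) \<omega> \<notin> N (x n) \<and> ?H \<omega>) = 0" by simp
  then have "AE \<omega> in M. \<omega> \<notin> {\<omega> \<in> space M. X (Suc n) \<omega> \<notin> N (x n) \<and> ?H \<omega>}"
    by (subst (asm) prob_eq_0) auto
  then show ?thesis by (auto elim!: AE_mp)
next
  case False
  then have "\<P>(\<omega> in M. \<forall>i\<le>n. X i \<omega> = x i) = 0" by (simp add: order_antisym not_less)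
  then have "AE \<omega> in M. \<omega> \<notin> {\<omega> \<in> space M. \<forall>i\<le>n. X i \<omega> = x i}"
    by (subst (asm) prob_eq_0) auto
  then show ?thesis by (auto elim!: AE_mp)
qed

text \<open>Links the process with \<open>visit\<close>, whose time 0 is the time
  \<open>Suc m\<close> of the process. The induction conditions on the next vertex and so lengthens
  the history by one, which is why \<open>m\<close> and \<open>x\<close> must be arbitrary.\<close>

lemma prob_visit:
  "\<P>(\<omega> in M. (\<forall>i\<le>Suc m. X i \<omega> = x i) \<and> (\<forall>j<n. X (Suc m + j) \<omega> \<in> A) \<and> X (Suc m + n) \<omega> \<in> B) =
    \<P>(\<omega> in M. \<forall>i\<le>Suc m. X i \<omega> = x i) * visit A B n (x m, x (Suc m))"
proof (induction n arbitrary: m x)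
  case 0
  show ?case
  proof (cases "x (Suc m) \<in> B")
    case True
    then have "(\<forall>i\<le>Suc m. X i \<omega> = x i) \<and> X (Suc m) \<omega> \<in> B \<longleftrightarrow> (\<forall>i\<le>Suc m. X i \<omega> = x i)" for \<omega>
      by auto
    then show ?thesis using True by simp
  next
    case False
    then have "{\<omega> \<in> space M. (\<forall>i\<le>Suc m. X i \<omega> = x i) \<and> (\<forall>j<0. X (Suc m + j) \<omega> \<in> A) \<and> X (Suc m + 0) \<omega> \<in> B} = {}"
      by force
    then show ?thesis using False by (simp only: visit.simps measure_empty) simp
  qed
next
  case (Suc n)
  let ?H = "\<lambda>\<omega>. \<forall>i\<le>Suc m. X i \<omega> = x i"
  let ?Q = "\<lambda>\<omega>. ?H \<omega> \<and> (\<forall>j<Suc n. X (Suc m + j) \<omega> \<in> A) \<and> X (Suc m + Suc n) \<omega> \<in> B"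
  let ?y = "x (Suc m)"
  show ?case
  proof (cases "0 < \<P>(\<omega> in M. ?H \<omega>)")
    case False
    then have 0: "\<P>(\<omega> in M. ?H \<omega>) = 0" by (simp add: order_antisym not_less)
    have "\<P>(\<omega> in M. ?Q \<omega>) \<le> \<P>(\<omega> in M. ?H \<omega>)" by (rule prob_mono) auto
    then show ?thesis using 0 by (simp add: measure_le_0_iff)
  next
    case True
    have V: "?y \<in> V" by (rule history_in_V[OF True]) simp
    show ?thesis
    proof (cases "?y \<in> A")
      case False
      have "\<not> ?Q \<omega>" for \<omega>
      proof
        assume Q: "?Q \<omega>"
        then have "X (Suc m + 0) \<omega> \<in> A" by blast
        with Q False show False by simp
      qed
      then have "{\<omega> \<in> space M. ?Q \<omega>} = {}" by blast
      then have "\<P>(\<omega> in M. ?Q \<omega>) = 0" by (simp only: measure_empty)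
      then show ?thesis using False by simp
    next
      case yA: True
      define x' where "x' z = x(Suc (Suc m) := z)" for z
      have x': "x' z (Suc m) = ?y" "x' z (Suc (Suc m)) = z" "(\<forall>i\<le>Suc m. X i \<omega> = x' z i) \<longleftrightarrow> ?H \<omega>"
        "x' z m = x m" for z \<omega>
        by (auto simp: x'_def)
      let ?Qz = "\<lambda>z \<omega>. (\<forall>i\<le>Suc (Suc m). X i \<omega> = x' z i) \<and>
        (\<forall>j<n. X (Suc (Suc m) + j) \<omega> \<in> A) \<and> X (Suc (Suc m) + n) \<omega> \<in> B"
      have Qz: "?Qz z \<omega> \<longleftrightarrow> ?Q \<omega> \<and> X (Suc (Suc m)) \<omega> = z" for z \<omega>
      proof -
        have a: "(\<forall>j<Suc n. X (Suc m + j) \<omega> \<in> A) \<longleftrightarrow> X (Suc m) \<omega> \<in> A \<and> (\<forall>j<n. X (Suc (Suc m) + j) \<omega> \<in> A)"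
          unfolding All_less_Suc2 by simp
        have b: "(\<forall>i\<le>Suc (Suc m). X i \<omega> = x' z i) \<longleftrightarrow> ?H \<omega> \<and> X (Suc (Suc m)) \<omega> = z"
        proof -
          have "(\<forall>i\<le>Suc (Suc m). X i \<omega> = x' z i) \<longleftrightarrow>
              (\<forall>i\<le>Suc m. X i \<omega> = x' z i) \<and> X (Suc (Suc m)) \<omega> = x' z (Suc (Suc m))"
            unfolding le_Suc_eq[of _ "Suc m"] by blast
          then show ?thesis unfolding x' .
        qed
        have c: "?H \<omega> \<Longrightarrow> X (Suc m) \<omega> \<in> A" using yA by simp
        have d: "Suc m + Suc n = Suc (Suc m) + n" by simp
        show ?thesis unfolding a b d using c by blast
      qed
      have "\<P>(\<omega> in M. ?Q \<omega>) = (\<Sum>z\<in>N ?y. \<P>(\<omega> in M. ?Qz z \<omega>))"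
      proof (rule prob_sum)
        show "AE \<omega> in M. (\<forall>z\<in>N ?y. ?Qz z \<omega> \<longrightarrow> ?Q \<omega>) \<and> (?Q \<omega> \<longrightarrow> (\<exists>!z\<in>N ?y. ?Qz z \<omega>))"
          using AE_step[of "Suc m" x]
        proof (rule AE_mp, intro AE_I2 impI)
          fix \<omega> assume "?H \<omega> \<longrightarrow> X (Suc (Suc m)) \<omega> \<in> N ?y"
          then show "(\<forall>z\<in>N ?y. ?Qz z \<omega> \<longrightarrow> ?Q \<omega>) \<and> (?Q \<omega> \<longrightarrow> (\<exists>!z\<in>N ?y. ?Qz z \<omega>))"
            unfolding Qz by blast
        qed
        show "finite (N ?y)" by (rule finite_N[OF V])
      qed measurable
      also have "\<dots> = (\<Sum>z\<in>N ?y. \<P>(\<omega> in M. ?H \<omega>) * (ker (x m) ?y z * visit A B n (?y, z)))"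
      proof (rule sum.cong[OF refl])
        fix z assume z: "z \<in> N ?y"
        have "\<P>(\<omega> in M. \<forall>i\<le>Suc (Suc m). X i \<omega> = x' z i) = \<P>(\<omega> in M. ?H \<omega>) * ker (x m) ?y z"
          unfolding prob_history_Suc[of "Suc m"] x' p_Suc using z by simp
        then show "\<P>(\<omega> in M. ?Qz z \<omega>) = \<P>(\<omega> in M. ?H \<omega>) * (ker (x m) ?y z * visit A B n (?y, z))"
          unfolding Suc.IH[of "Suc m" "x' z"] x' by simp
      qed
      also have "\<dots> = \<P>(\<omega> in M. ?H \<omega>) * visit A B (Suc n) (x m, ?y)"
        using yA by (simp add: T_def sum_distrib_left)
      finally show ?thesis .
    qed
  qed
qed

text \<open>The uniform first step supplies the edge \<open>(v, z)\<close> from which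
  \<open>visit\<close> starts, hence the shift of the time by one.\<close>

lemma prob_visit_start:
  "\<P>(\<omega> in M. X (Suc n) \<omega> = v) = (\<Sum>z\<in>N v. visit UNIV {v} n (v, z)) / card (N v)"
proof -
  define x where "x z = (\<lambda>i::nat. if i = 0 then v else z)" for z
  let ?Q = "\<lambda>z \<omega>. (\<forall>i\<le>Suc 0. X i \<omega> = x z i) \<and> (\<forall>j<n. X (Suc 0 + j) \<omega> \<in> UNIV) \<and> X (Suc 0 + n) \<omega> \<in> {v}"
  have Q: "?Q z \<omega> \<longleftrightarrow> X 0 \<omega> = v \<and> X (Suc 0) \<omega> = z \<and> X (Suc n) \<omega> = v" for z \<omega>
    by (auto simp: x_def le_Suc_eq)
  have "\<P>(\<omega> in M. X (Suc n) \<omega> = v) = (\<Sum>z\<in>N v. \<P>(\<omega> in M. ?Q z \<omega>))"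
  proof (rule prob_sum)
    show "AE \<omega> in M. (\<forall>z\<in>N v. ?Q z \<omega> \<longrightarrow> X (Suc n) \<omega> = v) \<and> (X (Suc n) \<omega> = v \<longrightarrow> (\<exists>!z\<in>N v. ?Q z \<omega>))"
      using AE_X_0 AE_step[of 0 "\<lambda>_. v"]
      by eventually_elim (unfold Q, auto)
    show "finite (N v)" by (rule finite_N[OF start])
  qed measurable
  also have "\<dots> = (\<Sum>z\<in>N v. 1 / card (N v) * visit UNIV {v} n (v, z))"
  proof (rule sum.cong[OF refl])
    fix z assume z: "z \<in> N v"
    have "\<P>(\<omega> in M. X 0 \<omega> = v) = 1"
      using AE_X_0 by (subst prob_Collect_eq_1) auto
    then have "\<P>(\<omega> in M. \<forall>i\<le>Suc 0. X i \<omega> = x z i) = 1 / card (N v)"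
      unfolding prob_history_Suc p_0 using z by (simp add: x_def)
    moreover have "x z 0 = v" "x z (Suc 0) = z" by (simp_all add: x_def)
    ultimately show "\<P>(\<omega> in M. ?Q z \<omega>) = 1 / card (N v) * visit UNIV {v} n (v, z)"
      using prob_visit[of 0 "x z" n UNIV "{v}"] by simp
  qed
  finally show ?thesis by (simp add: sum_divide_distrib)
qed

text \<open>The first Borel-Cantelli lemma. Its contrapositive turns recurrence into divergence of
  the Green function.\<close>

lemma finite_visits_if_green_finite:
  assumes "summable (\<lambda>n. \<Sum>z\<in>N v. visit UNIV {v} n (v, z))"
  shows "AE \<omega> in M. \<not> (\<exists>\<^sub>\<infinity>n. X n \<omega> = v)"
proof -
  let ?A = "\<lambda>n. {\<omega> \<in> space M. X (Suc n) \<omega> = v}"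
  have "AE \<omega> in M. eventually (\<lambda>n. \<omega> \<in> space M - ?A n) sequentially"
  proof (rule borel_cantelli_AE1)
    show "summable (\<lambda>n. measure M (?A n))"
      unfolding prob_visit_start by (rule summable_divide[OF assms])
    show "emeasure M (?A n) < \<infinity>" for n by (simp add: emeasure_eq_measure)
  qed measurable
  then show ?thesis
  proof eventually_elim
    case (elim \<omega>)
    then have "eventually (\<lambda>n. X (Suc n) \<omega> \<noteq> v) sequentially" by eventually_elim auto
    then have "eventually (\<lambda>n. X n \<omega> \<noteq> v) sequentially"
      by (rule eventually_sequentially_Suc[THEN iffD1])
    then show ?case by (simp add: frequently_def cofinite_eq_sequentially)
  qed
qed

text \<open>The graph walks from \<open>v\<close>, oldest position first. There are finitely many
  for each \<open>n\<close>, so almost sure statements can be combined over all of them although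
  \<open>V\<close> is not assumed countable.\<close>

primrec histories :: "nat \<Rightarrow> 'a list set" where
  "histories 0 = {[v]}"
| "histories (Suc n) = (\<Union>h\<in>histories n. (\<lambda>y. h @ [y]) ` N (last h))"

lemma histories: "h \<in> histories n \<Longrightarrow> length h = Suc n \<and> last h \<in> V"
proof (induction n arbitrary: h)
  case (Suc n)
  then obtain g y where g: "g \<in> histories n" "y \<in> N (last g)" "h = g @ [y]" by auto
  then show ?case using Suc.IH[OF g(1)] N_subset by auto
qed (use start in simp)

lemma finite_histories: "finite (histories n)"
  by (induction n) (auto intro!: finite_imageI finite_N dest: histories)

lemma AE_histories: "AE \<omega> in M. map (\<lambda>i. X i \<omega>) [0..<Suc n] \<in> histories n"
proof (induction n)
  case 0
  show ?case using AE_X_0 by simp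
next
  case (Suc n)
  have "AE \<omega> in M. \<forall>h\<in>histories n. (\<forall>i\<le>n. X i \<omega> = h ! i) \<longrightarrow> X (Suc n) \<omega> \<in> N (h ! n)"
    by (rule AE_finite_allI[OF finite_histories]) (rule AE_step)
  with Suc show ?case
  proof eventually_elim
    case (elim \<omega>)
    let ?h = "map (\<lambda>i. X i \<omega>) [0..<Suc n]"
    have "\<forall>i\<le>n. X i \<omega> = ?h ! i" by (simp add: less_Suc_eq_le nth_map_upt del: upt_Suc)
    then have "X (Suc n) \<omega> \<in> N (?h ! n)" by (rule bspec[OF elim(2,1), THEN mp])
    moreover have "?h ! n = last ?h" by (simp add: nth_append)
    ultimately have "X (Suc n) \<omega> \<in> N (last ?h)" by (simp only:)
    then have "?h @ [X (Suc n) \<omega>] \<in> histories (Suc n)"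
      unfolding histories.simps by (intro UN_I[OF elim(1)] imageI)
    then show ?case by simp
  qed
qed

text \<open>Only countably many histories have positive probability, so it suffices that, after each one
  of them ending in \<open>v\<close>, returning to \<open>v\<close> is almost sure.\<close>

lemma recurrent_if_escape_vanishes:
  assumes "\<And>z. z \<in> N v \<Longrightarrow> (\<lambda>n. visit (-{v}) (-{v}) n (v, z)) \<longlonglongrightarrow> 0"
  shows "AE \<omega> in M. \<exists>\<^sub>\<infinity>n. X n \<omega> = v"
proof -
  have no_return: "AE \<omega> in M. \<not> ((\<forall>i\<le>Suc m. X i \<omega> = x i) \<and> (\<forall>j. X (Suc m + j) \<omega> \<noteq> v))"
    if x: "x m = v" "x (Suc m) \<in> N v" for m x
  proof -
    let ?Q = "\<lambda>\<omega>. (\<forall>i\<le>Suc m. X i \<omega> = x i) \<and> (\<forall>j. X (Suc m + j) \<omega> \<noteq> v)"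
    let ?a = "\<lambda>n. visit (-{v}) (-{v}) n (v, x (Suc m))"
    have vz: "(v, x (Suc m)) \<in> E" using x start by (simp add: E_iff)
    have "\<P>(\<omega> in M. ?Q \<omega>) \<le> ?a n" for n
    proof -
      have "\<P>(\<omega> in M. ?Q \<omega>) \<le> \<P>(\<omega> in M. (\<forall>i\<le>Suc m. X i \<omega> = x i) \<and>
          (\<forall>j<n. X (Suc m + j) \<omega> \<in> -{v}) \<and> X (Suc m + n) \<omega> \<in> -{v})"
        by (rule prob_mono) auto
      also have "\<dots> = \<P>(\<omega> in M. \<forall>i\<le>Suc m. X i \<omega> = x i) * ?a n"
        using prob_visit[of m x n "-{v}" "-{v}"] x(1) by simp
      also have "\<dots> \<le> 1 * ?a n"
        by (intro mult_right_mono prob_le_1 visit_nonneg vz)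
      finally show ?thesis by simp
    qed
    then have "\<P>(\<omega> in M. ?Q \<omega>) \<le> 0"
      by (intro LIMSEQ_le_const[OF assms[OF x(2)]]) auto
    then have "\<P>(\<omega> in M. ?Q \<omega>) = 0" by (simp add: measure_le_0_iff)
    then have "AE \<omega> in M. \<omega> \<notin> {\<omega> \<in> space M. ?Q \<omega>}"
      by (subst (asm) prob_eq_0) auto
    then show ?thesis by (rule AE_mp) auto
  qed
  have "AE \<omega> in M. \<forall>m. \<forall>h\<in>histories (Suc m). h ! m = v \<longrightarrow> h ! Suc m \<in> N v \<longrightarrow>
      \<not> ((\<forall>i\<le>Suc m. X i \<omega> = h ! i) \<and> (\<forall>j. X (Suc m + j) \<omega> \<noteq> v))"
    unfolding AE_all_countable
  proof (intro allI AE_finite_allI[OF finite_histories])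
    fix m h
    show "AE \<omega> in M. h ! m = v \<longrightarrow> h ! Suc m \<in> N v \<longrightarrow>
        \<not> ((\<forall>i\<le>Suc m. X i \<omega> = h ! i) \<and> (\<forall>j. X (Suc m + j) \<omega> \<noteq> v))"
    proof (cases "h ! m = v \<and> h ! Suc m \<in> N v")
      case True
      then show ?thesis using no_return[of "\<lambda>i. h ! i" m] by simp
    qed auto
  qed
  moreover have "AE \<omega> in M. \<forall>n. map (\<lambda>i. X i \<omega>) [0..<Suc n] \<in> histories n"
    unfolding AE_all_countable using AE_histories by blast
  ultimately show ?thesis using AE_X_0
  proof eventually_elim
    case (elim \<omega>)
    show ?case
    proof (rule ccontr)
      assume "\<not> (\<exists>\<^sub>\<infinity>n. X n \<omega> = v)"
      then have fin: "finite {n. X n \<omega> = v}" by (simp add: frequently_cofinite)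
      \<comment> \<open>The last visit to \<open>v\<close>, which exists because the walk starts
        there. The history up to one step later is one of those after which never returning has been
        excluded.\<close>
      define m where "m = Max {n. X n \<omega> = v}"
      have "m \<in> {n. X n \<omega> = v}" unfolding m_def by (rule Max_in[OF fin]) (use elim(3) in auto)
      then have m: "X m \<omega> = v" by simp
      have later: "X n \<omega> \<noteq> v" if "m < n" for n
        using Max_ge[OF fin, of n] that by (auto simp: m_def)
      let ?h = "map (\<lambda>i. X i \<omega>) [0..<Suc (Suc m)]" and ?g = "map (\<lambda>i. X i \<omega>) [0..<Suc m]"
      have h: "?h ! i = X i \<omega>" if "i \<le> Suc m" for i
        using that by (simp add: less_Suc_eq_le nth_map_upt del: upt_Suc)
      have "?h \<in> histories (Suc m)" using elim(2) by blast
      then obtain g y where g: "g \<in> histories m" "y \<in> N (last g)" "?h = g @ [y]" by auto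
      have "?h = ?g @ [X (Suc m) \<omega>]" by simp
      with g(3) have "g = ?g" "y = X (Suc m) \<omega>" by auto
      moreover have "last ?g = X m \<omega>" by simp
      ultimately have "X (Suc m) \<omega> \<in> N v" using g(2) m by simp
      moreover have "?h ! m = v" "?h ! Suc m = X (Suc m) \<omega>" using h[of m] h[of "Suc m"] m by (simp_all only: le_SucI le_refl)
      ultimately have "\<not> ((\<forall>i\<le>Suc m. X i \<omega> = ?h ! i) \<and> (\<forall>j. X (Suc m + j) \<omega> \<noteq> v))"
        using elim(1) \<open>?h \<in> histories (Suc m)\<close> by (simp only: simp_thms)
      moreover have "\<forall>i\<le>Suc m. X i \<omega> = ?h ! i" using h by metis
      moreover have "\<forall>j. X (Suc m + j) \<omega> \<noteq> v" using later by simp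
      ultimately show False by blast
    qed
  qed
qed

end

lemma (in walk_process) green_diverges_if_recurrent:
  assumes "AE \<omega> in M. \<exists>\<^sub>\<infinity>n. X n \<omega> = v"
  shows "\<not> summable (\<lambda>n. \<Sum>z\<in>N v. visit UNIV {v} n (v, z))"
proof
  assume "summable (\<lambda>n. \<Sum>z\<in>N v. visit UNIV {v} n (v, z))"
  from finite_visits_if_green_finite[OF this] assms have "AE \<omega> in M. False"
    by eventually_elim simp
  then show False by (simp add: AE_False)
qed

section \<open>Comparison of the two walks on graphs with degrees 2 and \<open>k\<close>\<close>

theorem proposition2:
  fixes G :: "'a pair_pre_digraph" and k :: nat and L :: real
  assumes "pair_bidirected_digraph G"
    and "Digraph_Component.connected (with_proj G)"
    and "k > 2"
    and "\<And>x. x \<in> pverts G \<Longrightarrow> deg G x = 2 \<or> deg G x = k"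
    and "L > 0"
    and "\<And>p. vpath p (with_proj G) \<Longrightarrow> (\<And>x. x \<in> set p \<Longrightarrow> deg G x = 2) \<Longrightarrow>
           real (vwalk_length p) \<le> L"
  shows "nbrw_recurrent G \<longleftrightarrow> srw_recurrent G"
proof -
  interpret pair_bidirected_digraph G by fact
  let ?V = "pverts G" and ?N = "nbrs G"
  have N_V: "y \<in> ?V" "x \<in> ?V" if "y \<in> ?N x" for x y
    using that by (auto simp: nbrs_def dest: in_arcsD1 in_arcsD2)
  have deg: "deg G x = 2 \<or> deg G x = k" "2 \<le> deg G x" "deg G x \<le> k" if "x \<in> ?V" for x
    using assms(3) assms(4)[OF that] by auto
  interpret graph: bounded_degree_graph ?V ?N k
  proof
    fix x assume x: "x \<in> ?V"
    have "0 < card (?N x)" using deg(2)[OF x] by (simp add: deg_def)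
    then show "finite (?N x)" "?N x \<noteq> {}" by (simp_all add: card_gt_0_iff)
    show "?N x \<subseteq> ?V" using N_V by blast
    show "card (?N x) \<le> k" using deg(3)[OF x] by (simp add: deg_def)
    show "x \<in> ?N y" if "y \<in> ?N x" for y
      using that arcs_ends_symmetric[OF pair_sym_arcs] by (simp add: nbrs_def)
  qed
  interpret srw: edge_walk ?V ?N k "\<lambda>_. 0" 1
    by unfold_locales simp_all
  define \<rho> where "\<rho> x = 1 / (real (deg G x) - 1)" for x
  have \<rho>: "0 \<le> \<rho> x" "\<rho> x \<le> 1" "\<rho> x * card (?N x) = 1 + \<rho> x" "\<rho> x = 1 \<longleftrightarrow> deg G x = 2" if "x \<in> ?V" for x
    using deg(2)[OF that] by (auto simp: \<rho>_def deg_def[symmetric] field_simps)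
  \<comment> \<open>Apart from 1, the only value of \<open>\<rho>\<close> is
    \<open>1 / (k - 1)\<close>, at vertices of degree \<open>k\<close>; this gives the gap, which is
    positive since \<open>k > 2\<close>.\<close>
  interpret nbrw: edge_walk ?V ?N k \<rho> "1 - (1 / (real k - 1))\<^sup>2"
  proof
    show "0 < 1 - (1 / (real k - 1))\<^sup>2"
      using assms(3) by (simp add: power_divide)
    show "1 - (1 / (real k - 1))\<^sup>2 \<le> 1 - (\<rho> x)\<^sup>2" if "x \<in> ?V" "\<rho> x \<noteq> 1" for x
      using deg(1)[OF that(1)] \<rho>(4)[OF that(1)] that(2) by (simp add: \<rho>_def)
  qed (use \<rho> in simp_all)
  have srw: "walk_process ?V ?N k (\<lambda>_. 0) 1 (srw_transition G) v M X"
    if "v \<in> ?V" "simple_random_walk G v M X" for v and M :: "(nat \<Rightarrow> 'a) measure" and X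
    using that
    by unfold_locales (simp_all add: simple_random_walk_def srw_transition_def deg_def srw.ker_def)
  have nbrw: "walk_process ?V ?N k \<rho> (1 - (1 / (real k - 1))\<^sup>2) (nbrw_transition G) v M X"
    if "v \<in> ?V" "nonbacktracking_random_walk G v M X" for v and M :: "(nat \<Rightarrow> 'a) measure" and X
  proof
    fix n and x :: "nat \<Rightarrow> 'a" and y
    show "nbrw_transition G (Suc n) x y =
        (if y \<in> ?N (x (Suc n)) then nbrw.ker (x n) (x (Suc n)) y else 0)"
    proof (cases "y \<in> ?N (x (Suc n))")
      case True
      have "2 \<le> deg G (x (Suc n))" using deg(2) N_V(2)[OF True] by blast
      then show ?thesis
        by (auto simp: nbrw_transition_def nbrw.ker_def \<rho>_def deg_def[symmetric] field_simps)
    qed (simp add: nbrw_transition_def)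
  qed (use that in \<open>simp_all add: nonbacktracking_random_walk_def nbrw_transition_def deg_def\<close>)
  show ?thesis
  proof
    assume rec: "nbrw_recurrent G"
    show "srw_recurrent G"
      unfolding srw_recurrent_def recurrent_on_def
    proof (intro ballI allI impI)
      fix v and M :: "(nat \<Rightarrow> 'a) measure" and X
      assume v: "v \<in> ?V" and MX: "simple_random_walk G v M X"
      \<comment> \<open>Recurrence speaks about all processes, so one has to exist before divergence
        of the Green function can be drawn from it.\<close>
      obtain M' :: "(nat \<Rightarrow> 'a) measure" and X' where MX': "nonbacktracking_random_walk G v M' X'"
        using ex_nonbacktracking_random_walk[OF assms(1) v deg(2)] by blast
      interpret w': walk_process ?V ?N k \<rho> "1 - (1 / (real k - 1))\<^sup>2" "nbrw_transition G" v M' X'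
        by (rule nbrw[OF v MX'])
      interpret w: walk_process ?V ?N k "\<lambda>_. 0" 1 "srw_transition G" v M X
        by (rule srw[OF v MX])
      have "AE \<omega> in M'. \<exists>\<^sub>\<infinity>n. X' n \<omega> = v"
        using rec v MX' by (simp add: nbrw_recurrent_def recurrent_on_def)
      note small = nbrw.small_energy_if_green_diverges[OF v w'.green_diverges_if_recurrent[OF this]]
      \<comment> \<open>For simple random walk \<open>\<rho> = 0\<close> everywhere, so the
        constancy condition in \<open>escape_vanishes\<close> is met vacuously and no contraction is
        made.\<close>
      show "AE \<omega> in M. \<exists>\<^sub>\<infinity>n. X n \<omega> = v"
        by (rule w.recurrent_if_escape_vanishes, rule srw.escape_vanishes[OF v]) (use small in simp_all)
    qed
  next
    assume rec: "srw_recurrent G"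
    define R where "R = {(x, y) \<in> parcs G. deg G x = 2 \<and> deg G y = 2}"
    have R: "R \<subseteq> graph.E" "sym R"
      using N_V arcs_ends_symmetric[OF pair_sym_arcs]
      by (auto simp: R_def graph.E_iff nbrs_def sym_def)
    have Field: "x \<in> ?V \<and> deg G x = 2" if "x \<in> Field R" for x
      using that by (auto simp: R_def Field_def dest: in_arcsD1 in_arcsD2)
    \<comment> \<open>Two distinct vertices related by \<open>R\<^sup>*\<close> are joined by a path
      of vertices of degree 2, whose number of edges is at most \<open>L\<close> by
      hypothesis.\<close>
    have short: "\<exists>j\<le>nat \<lceil>L\<rceil>. (x, y) \<in> R ^^ j" if xy: "(x, y) \<in> R\<^sup>*" for x y
    proof (cases "x = y")
      case True
      then show ?thesis by (intro exI[of _ 0]) simp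
    next
      case False
      obtain p where p: "p \<noteq> []" "hd p = x" "last p = y" "distinct p"
        "set p \<subseteq> insert y (Field R)" "set (vwalk_arcs p) \<subseteq> R"
        using rtrancl_imp_vpath[OF xy] by blast
      have "y \<in> Field R" using xy False by (metis FieldI2 rtranclE)
      then have F: "set p \<subseteq> Field R" using p(5) by blast
      have "vpath p (with_proj G)"
      proof (intro vpathI vwalkI p(1,4))
        show "set p \<subseteq> verts (with_proj G)" using F Field by auto
        show "set (vwalk_arcs p) \<subseteq> arcs_ends (with_proj G)"
          using p(6) by (auto simp: R_def)
      qed
      moreover have "deg G u = 2" if "u \<in> set p" for u using F Field that by blast
      ultimately have "real (vwalk_length p) \<le> L" by (rule assms(6))
      then have "real (length p - 1) \<le> L" by (simp only: vwalk_length_simp)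
      then have "length p - 1 \<le> nat \<lceil>L\<rceil>" by linarith
      then show ?thesis using vwalk_arcs_imp_relpow[OF p(1,6)] p(2,3) by blast
    qed
    show "nbrw_recurrent G"
      unfolding nbrw_recurrent_def recurrent_on_def
    proof (intro ballI allI impI)
      fix v and M :: "(nat \<Rightarrow> 'a) measure" and X
      assume v: "v \<in> ?V" and MX: "nonbacktracking_random_walk G v M X"
      have "1 \<le> deg G x" if "x \<in> ?V" for x using deg(2)[OF that] by simp
      then obtain M' :: "(nat \<Rightarrow> 'a) measure" and X' where MX': "simple_random_walk G v M' X'"
        using ex_simple_random_walk[OF assms(1) v] by blast
      interpret w': walk_process ?V ?N k "\<lambda>_. 0" 1 "srw_transition G" v M' X'
        by (rule srw[OF v MX'])
      interpret w: walk_process ?V ?N k \<rho> "1 - (1 / (real k - 1))\<^sup>2" "nbrw_transition G" v M X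
        by (rule nbrw[OF v MX])
      have "AE \<omega> in M'. \<exists>\<^sub>\<infinity>n. X' n \<omega> = v"
        using rec v MX' by (simp add: srw_recurrent_def recurrent_on_def)
      note small = srw.small_energy_if_green_diverges[OF v w'.green_diverges_if_recurrent[OF this]]
      show "AE \<omega> in M. \<exists>\<^sub>\<infinity>n. X n \<omega> = v"
      proof (rule w.recurrent_if_escape_vanishes, rule nbrw.escape_vanishes[OF v])
        fix \<epsilon> :: real assume \<epsilon>: "0 < \<epsilon>"
        \<comment> \<open>The factor lost in \<open>contract_energy\<close>, compensated by starting
          from energy at most \<open>\<epsilon> / C\<close>. An edge with \<open>\<rho> = 1\<close>
          at both ends lies in \<open>R\<close>, so the contracted function is constant on
          it.\<close>
        define C where "C = 6 * real k * graph.path_const (nat \<lceil>L\<rceil>) + 3"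
        have C: "0 < C" using graph.path_const_nonneg[of "nat \<lceil>L\<rceil>"] by (simp add: C_def add_nonneg_pos)
        then obtain \<phi> where \<phi>: "\<phi> v = 1" "\<phi> summable_on ?V" "\<And>x. x \<in> ?V \<Longrightarrow> 0 \<le> \<phi> x" "graph.energy \<phi> \<le> \<epsilon> / C"
          using small[of "\<epsilon> / C"] \<epsilon> by auto
        obtain \<psi> :: "'a \<Rightarrow> real" where \<psi>: "\<psi> v = 1" "\<psi> summable_on ?V" "\<forall>x\<in>?V. 0 \<le> \<psi> x"
          "\<forall>x y. (x, y) \<in> R \<longrightarrow> \<psi> x = \<psi> y" "graph.energy \<psi> \<le> C * graph.energy \<phi>"
          using graph.contract_energy[OF v R short \<phi>(1-3)] by (auto simp: C_def)
        have "C * graph.energy \<phi> \<le> \<epsilon>" using \<phi>(4) C by (simp add: field_simps)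
        moreover have "(x, y) \<in> R" if "(x, y) \<in> graph.E" "\<rho> x = 1" "\<rho> y = 1" for x y
          using that \<rho>(4) N_V by (auto simp: R_def graph.E_iff nbrs_def)
        ultimately show "\<exists>\<phi>. \<phi> v = 1 \<and> \<phi> summable_on ?V \<and> (\<forall>x\<in>?V. 0 \<le> \<phi> x) \<and>
            (\<forall>x y. (x, y) \<in> graph.E \<longrightarrow> \<rho> x = 1 \<longrightarrow> \<rho> y = 1 \<longrightarrow> \<phi> x = \<phi> y) \<and> graph.energy \<phi> \<le> \<epsilon>"
          using \<psi> by (intro exI[of _ \<psi>]) auto
      qed
    qed
  qed
qed

end
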